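(* Let $A\in\mathcal{B}(\mathcal{H})$ be a normal operator on a complex separable Hilbert space $\mathcal{H}$, let $\mathcal{G}$ be a (countable) Bessel system of vectors in $\mathcal{H}$, and let $0<L<\infty$. (1) If $\{A^tg\}_{g\in\mathcal{G},\,t\in[0,L]}$ is a semi-continuous frame for $\mathcal{H}$, then there exists $\delta>0$ such that for any finite set $T=\{t_i:i=1,\ldots,n\}$ with $0=t_1<t_2<\ldots<t_n<t_{n+1}=L$ and $|t_{i+1}-t_i|<\delta$ for $i=1,\dots,n$, the system $\{A^tg\}_{g\in\mathcal{G},\,t\in T}$ is a frame for $\mathcal{H}$. (2) If, in addition, $A$ is invertible, then $\{A^tg\}_{g\in\mathcal{G},\,t\in[0,L]}$ is a semi-continuous frame for $\mathcal{H}$ if and only if there exists a finite set $T=\{t_i:i=1,\ldots,n\}$ with $0=t_1<t_2<\ldots<t_n<L$ such that $\{A^tg\}_{g\in\mathcal{G},\,t\in T}$ is a frame for $\mathcal{H}$.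
   Context: $\mathcal{G}$ is a Bessel system in $\mathcal{H}$ if there is $C>0$ with $\sum_{g\in\mathcal{G}}|\langle f,g\rangle|^2\le C\|f\|^2$ for all $f\in\mathcal{H}$. $\{A^tg\}_{g\in\mathcal{G},t\in[0,L]}$ is a semi-continuous frame for $\mathcal{H}$ if there are constants $c,C>0$ with $c\|f\|^2\le\sum_{g\in\mathcal{G}}\int_0^L|\langle f,A^tg\rangle|^2dt\le C\|f\|^2$ for all $f\in\mathcal{H}$. For finite $T$, $\{A^tg\}_{g\in\mathcal{G},t\in T}$ is a frame for $\mathcal{H}$ if there are $c,C>0$ with $c\|f\|^2\le\sum_{g\in\mathcal{G}}\sum_{t\in T}|\langle f,A^tg\rangle|^2\le C\|f\|^2$ for all $f\in\mathcal{H}$. Invertible means having a bounded inverse. For a normal operator $A$ with spectral measure $E$, $A^t=\int_{\sigma(A)}z^t\,dE(z)$, where $z^t=\exp(t(\ln|z|+i\arg z))$ with $\arg z\in[-\pi,\pi)$ for $z\ne0$, and $0^t=0$ for $t>0$, $0^0=1$ (so $A^0=I$). *)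

theory Defs
  imports "HOL-Analysis.Analysis"
begin

section \<open>Complex Hilbert spaces\<close>

class complex_inner = real_normed_vector +
  fixes scaleC :: "complex \<Rightarrow> 'a \<Rightarrow> 'a" (infixr "*\<^sub>C" 75)
    and cinner :: "'a \<Rightarrow> 'a \<Rightarrow> complex"
  assumes scaleC_of_real: "of_real r *\<^sub>C x = r *\<^sub>R x"
    and scaleC_add_right: "a *\<^sub>C (x + y) = a *\<^sub>C x + a *\<^sub>C y"
    and scaleC_add_left: "(a + b) *\<^sub>C x = a *\<^sub>C x + b *\<^sub>C x"
    and scaleC_scaleC: "a *\<^sub>C b *\<^sub>C x = (a * b) *\<^sub>C x"
    and scaleC_one: "1 *\<^sub>C x = x"
    and cinner_commute: "cinner x y = cnj (cinner y x)"
    and cinner_add_left: "cinner (x + y) z = cinner x z + cinner y z"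
    and cinner_scaleC_left: "cinner (a *\<^sub>C x) y = a * cinner x y"
    and cinner_self_nonneg: "0 \<le> Re (cinner x x)"
    and cinner_eq_zero_iff: "cinner x x = 0 \<longleftrightarrow> x = 0"
    and norm_eq_sqrt_cinner: "norm x = sqrt (Re (cinner x x))"

class chilbert_space = complex_inner + banach

instantiation complex :: chilbert_space
begin

definition scaleC_complex :: "complex \<Rightarrow> complex \<Rightarrow> complex"
  where "scaleC_complex a x = a * x"

definition cinner_complex :: "complex \<Rightarrow> complex \<Rightarrow> complex"
  where "cinner_complex x y = x * cnj y"

instance
  by standard
    (auto simp: scaleC_complex_def cinner_complex_def scaleR_conv_of_real algebra_simps
      cmod_def power2_eq_square)

end



section \<open>Bounded operators\<close>

definition bounded_clinear :: "('a::complex_inner \<Rightarrow> 'b::complex_inner) \<Rightarrow> bool"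
  where "bounded_clinear A \<longleftrightarrow> bounded_linear A \<and> (\<forall>a x. A (a *\<^sub>C x) = a *\<^sub>C A x)"

definition cadjoint :: "('a::complex_inner \<Rightarrow> 'a) \<Rightarrow> 'a \<Rightarrow> 'a"
  where "cadjoint A = (THE B. \<forall>x y. cinner (A x) y = cinner x (B y))"

definition normal_operator :: "('a::complex_inner \<Rightarrow> 'a) \<Rightarrow> bool"
  where "normal_operator A \<longleftrightarrow> bounded_clinear A \<and> A \<circ> cadjoint A = cadjoint A \<circ> A"

definition invertible_operator :: "('a::complex_inner \<Rightarrow> 'a) \<Rightarrow> bool"
  where "invertible_operator A \<longleftrightarrow> (\<exists>B. bounded_clinear B \<and> A \<circ> B = id \<and> B \<circ> A = id)"

definition spectrum :: "('a::complex_inner \<Rightarrow> 'a) \<Rightarrow> complex set"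
  where "spectrum A = {z. \<not> invertible_operator (\<lambda>x. A x - z *\<^sub>C x)}"

definition orthogonal_projection :: "('a::complex_inner \<Rightarrow> 'a) \<Rightarrow> bool"
  where "orthogonal_projection P \<longleftrightarrow>
    bounded_clinear P \<and> P \<circ> P = P \<and> (\<forall>x y. cinner (P x) y = cinner x (P y))"


section \<open>Spectral measures and spectral integrals\<close>

definition projection_valued_measure :: "(complex set \<Rightarrow> 'a::complex_inner \<Rightarrow> 'a) \<Rightarrow> bool"
  where "projection_valued_measure E \<longleftrightarrow>
    (\<forall>S \<in> sets borel. orthogonal_projection (E S)) \<and>
    E {} = (\<lambda>x. 0) \<and> E UNIV = id \<and>
    (\<forall>S \<in> sets borel. \<forall>T \<in> sets borel. E (S \<inter> T) = E S \<circ> E T) \<and>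
    (\<forall>S :: nat \<Rightarrow> complex set. range S \<subseteq> sets borel \<longrightarrow> disjoint_family S \<longrightarrow>
      (\<forall>x. (\<lambda>n. E (S n) x) sums E (\<Union>n. S n) x))"

text \<open>The finite measure \<open>S \<mapsto> \<langle>E(S)x, x\<rangle>\<close>.\<close>

definition scalar_measure ::
    "(complex set \<Rightarrow> 'a::complex_inner \<Rightarrow> 'a) \<Rightarrow> 'a \<Rightarrow> complex measure"
  where "scalar_measure E x =
    measure_of UNIV (sets borel) (\<lambda>S. ennreal (Re (cinner (E S x) x)))"

text \<open>
  \<open>B = \<integral>\<^sub>K f dE\<close>, in the weak sense: \<open>\<langle>Bx, x\<rangle> = \<integral>\<^sub>K f d\<langle>E(\<cdot>)x, x\<rangle>\<close> for all \<open>x\<close>. As the scalars are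
  complex, the quadratic form determines \<open>B\<close> (polarization), so \<open>B\<close> is unique.
\<close>

definition has_spectral_integral ::
    "(complex set \<Rightarrow> 'a::complex_inner \<Rightarrow> 'a) \<Rightarrow> complex set \<Rightarrow> (complex \<Rightarrow> complex) \<Rightarrow>
      ('a \<Rightarrow> 'a) \<Rightarrow> bool"
  where "has_spectral_integral E K f B \<longleftrightarrow> bounded_clinear B \<and>
    (\<forall>x. set_integrable (scalar_measure E x) K f \<and>
         cinner (B x) x = set_lebesgue_integral (scalar_measure E x) K f)"

definition spectral_integral ::
    "(complex set \<Rightarrow> 'a::complex_inner \<Rightarrow> 'a) \<Rightarrow> complex set \<Rightarrow> (complex \<Rightarrow> complex) \<Rightarrow> 'a \<Rightarrow> 'a"
  where "spectral_integral E K f = (THE B. has_spectral_integral E K f B)"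

text \<open>
  A spectral measure on the Borel subsets of \<open>\<sigma>(A)\<close> is represented by its extension by zero to the
  Borel subsets of the plane.
\<close>

definition spectral_measure_of ::
    "('a::complex_inner \<Rightarrow> 'a) \<Rightarrow> (complex set \<Rightarrow> 'a \<Rightarrow> 'a) \<Rightarrow> bool"
  where "spectral_measure_of A E \<longleftrightarrow>
    projection_valued_measure E \<and> E (spectrum A) = id \<and>
    has_spectral_integral E (spectrum A) (\<lambda>z. z) A"


section \<open>Continuous powers\<close>

text \<open>The argument in \<open>[-\<pi>, \<pi>)\<close>; the library's \<^const>\<open>Arg\<close> takes values in \<open>(-\<pi>, \<pi>]\<close>.\<close>

definition arg_lower :: "complex \<Rightarrow> real"
  where "arg_lower z = (if Arg z = pi then - pi else Arg z)"

lemma arg_lower_bounds: "- pi \<le> arg_lower z \<and> arg_lower z < pi"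
  using Arg_bounded[of z] by (auto simp: arg_lower_def)

lemma arg_lower_polar: "z = of_real (cmod z) * cis (arg_lower z)"
proof -
  have "cis (arg_lower z) = cis (Arg z)"
    by (auto simp: arg_lower_def complex_eq_iff)
  then show ?thesis
    using rcis_cmod_Arg[of z] by (simp add: rcis_def)
qed

definition cpower :: "complex \<Rightarrow> real \<Rightarrow> complex"
  where "cpower z t =
    (if z = 0 then (if t = 0 then 1 else 0)
     else exp (of_real t * (of_real (ln (cmod z)) + \<i> * of_real (arg_lower z))))"

text \<open>\<open>A\<^sup>t\<close>, where \<open>E\<close> is the spectral measure of \<open>A\<close>.\<close>

definition operator_power ::
    "('a::complex_inner \<Rightarrow> 'a) \<Rightarrow> (complex set \<Rightarrow> 'a \<Rightarrow> 'a) \<Rightarrow> real \<Rightarrow> 'a \<Rightarrow> 'a"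
  where "operator_power A E t = spectral_integral E (spectrum A) (\<lambda>z. cpower z t)"


section \<open>Bessel systems and frames\<close>

text \<open>
  A system of vectors is a family \<open>(g i)\<^bsub>i \<in> I\<^esub>\<close>, so repetitions are allowed; a set \<open>G\<close> of vectors
  is the case \<open>I = G\<close>, \<open>g = id\<close>. Sums and integrals are taken in \<open>[0, \<infinity>]\<close>. The parameter \<open>P\<close>
  stands for \<open>t \<mapsto> A\<^sup>t\<close>.
\<close>

definition bessel_system :: "'i set \<Rightarrow> ('i \<Rightarrow> 'a::complex_inner) \<Rightarrow> bool"
  where "bessel_system I g \<longleftrightarrow>
    (\<exists>C>0. \<forall>f. (\<Sum>\<^sub>\<infinity>i\<in>I. ennreal ((cmod (cinner f (g i)))\<^sup>2)) \<le> ennreal (C * (norm f)\<^sup>2))"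

definition semicontinuous_frame ::
    "(real \<Rightarrow> 'a \<Rightarrow> 'a) \<Rightarrow> 'i set \<Rightarrow> ('i \<Rightarrow> 'a::complex_inner) \<Rightarrow> real \<Rightarrow> bool"
  where "semicontinuous_frame P I g L \<longleftrightarrow>
    (\<exists>c>0. \<exists>C>0. \<forall>f.
      ennreal (c * (norm f)\<^sup>2)
        \<le> (\<Sum>\<^sub>\<infinity>i\<in>I. \<integral>\<^sup>+t\<in>{0..L}. ennreal ((cmod (cinner f (P t (g i))))\<^sup>2) \<partial>lborel) \<and>
      (\<Sum>\<^sub>\<infinity>i\<in>I. \<integral>\<^sup>+t\<in>{0..L}. ennreal ((cmod (cinner f (P t (g i))))\<^sup>2) \<partial>lborel)
        \<le> ennreal (C * (norm f)\<^sup>2))"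

definition discrete_frame ::
    "(real \<Rightarrow> 'a \<Rightarrow> 'a) \<Rightarrow> 'i set \<Rightarrow> ('i \<Rightarrow> 'a::complex_inner) \<Rightarrow> real set \<Rightarrow> bool"
  where "discrete_frame P I g T \<longleftrightarrow>
    (\<exists>c>0. \<exists>C>0. \<forall>f.
      ennreal (c * (norm f)\<^sup>2)
        \<le> (\<Sum>\<^sub>\<infinity>i\<in>I. \<Sum>t\<in>T. ennreal ((cmod (cinner f (P t (g i))))\<^sup>2)) \<and>
      (\<Sum>\<^sub>\<infinity>i\<in>I. \<Sum>t\<in>T. ennreal ((cmod (cinner f (P t (g i))))\<^sup>2))
        \<le> ennreal (C * (norm f)\<^sup>2))"

end

theory Submission
  imports Defs "HOL-Complex_Analysis.Cauchy_Integral_Theorem"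
begin

text \<open>
  Let \<open>\<phi> t = \<Sum>i\<in>I. \<bar>\<langle>f, A\<^sup>t g\<^sub>i\<rangle>\<bar>\<^sup>2\<close>. Moving \<open>A\<^sup>t\<close> to the other side, the Bessel bound gives
  \<open>\<phi> t \<le> 2 \<phi> s + 2 C \<parallel>A\<^sup>t - A\<^sup>s\<parallel>\<^sup>2 \<parallel>f\<parallel>\<^sup>2\<close>, so sums and integrals of \<open>\<phi>\<close> can be compared wherever
  \<open>t \<mapsto> A\<^sup>t\<close> is uniformly norm continuous. This is the case on \<open>[\<eta>, L]\<close> for every \<open>\<eta> > 0\<close>, and on
  \<open>[0, L]\<close> if \<open>A\<close> is invertible, since then \<open>E\<close> vanishes near 0. In part (1) the contribution of
  \<open>[0, 2\<eta>]\<close> to the integral is absorbed into the lower frame bound.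
\<close>

section \<open>Complex inner products and numerical radius\<close>

text \<open>The obstacle sits at \<open>z = 0\<close>, \<open>t = 0\<close>:
  \<open>cpower 0 0\<close> is 1 while \<open>cpower 0 t\<close> is 0 for \<open>t > 0\<close>, and
  for small nonzero \<open>z\<close> the modulus of \<open>cpower z t\<close> falls from 1
  arbitrarily fast. So the powers need not be norm continuous at 0. What survives there is a bound
  on \<phi> uniform in \<open>t\<close>; hence a short initial interval contributes little, and
  \<eta> can be fixed from the frame and Bessel constants before any mesh is chosen.

  The powers are accessible only through the quadratic forms in
  \<open>has_spectral_integral\<close>. Polarization turns information on forms into operator
  bounds, uniqueness and adjoints; the factors 2 in the operator bounds come from there. The
  location of the support of \<open>E\<close> is read off in the same way: a vector in the range of
  \<open>E S\<close> sees only the points of \<open>S\<close>, which conflicts with the boundedness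
  of \<open>A\<close> if \<open>S\<close> lies too far out, and with that of its inverse if
  \<open>S\<close> lies too close to 0.

  All frame inequalities are proved for finite subfamilies, with constants independent of the
  subfamily.\<close>

lemma scaleC_minus_one: "(-1) *\<^sub>C x = - (x::'a::complex_inner)"
  using scaleC_of_real[of "-1" x] by simp

lemma cinner_add_right: "cinner x (y + z) = cinner x y + cinner (x::'a::complex_inner) z"
  by (metis cinner_add_left cinner_commute complex_cnj_add)

lemma cinner_scaleC_right: "cinner x (a *\<^sub>C y) = cnj a * cinner (x::'a::complex_inner) y"
  by (metis cinner_scaleC_left cinner_commute complex_cnj_mult)

lemma cinner_minus_left: "cinner (- x) y = - cinner (x::'a::complex_inner) y"
  by (metis cinner_scaleC_left scaleC_minus_one mult_minus1)

lemma cinner_minus_right: "cinner x (- y) = - cinner (x::'a::complex_inner) y"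
  by (metis cinner_minus_left cinner_commute complex_cnj_minus)

lemma cinner_diff_left: "cinner (x - y) z = cinner x z - cinner (y::'a::complex_inner) z"
  using cinner_add_left[of x "-y" z] by (simp add: cinner_minus_left)

lemma cinner_diff_right: "cinner z (x - y) = cinner z x - cinner (z::'a::complex_inner) y"
  using cinner_add_right[of z x "-y"] by (simp add: cinner_minus_right)

lemma cinner_zero_left [simp]: "cinner 0 (x::'a::complex_inner) = 0"
  using cinner_diff_left[of 0 0 x] by simp

lemma cinner_zero_right [simp]: "cinner (x::'a::complex_inner) 0 = 0"
  using cinner_diff_right[of x 0 0] by simp

lemma cinner_scaleR_left: "cinner (r *\<^sub>R x) y = of_real r * cinner (x::'a::complex_inner) y"
  by (metis cinner_scaleC_left scaleC_of_real)

lemma cinner_scaleR_right: "cinner x (r *\<^sub>R y) = of_real r * cinner (x::'a::complex_inner) y"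
  by (metis cinner_scaleC_right scaleC_of_real complex_cnj_complex_of_real)

lemma cinner_self: "cinner x x = of_real ((norm (x::'a::complex_inner))\<^sup>2)"
proof -
  have "Im (cinner x x) = 0"
    using arg_cong[OF cinner_commute[of x x], of Im] by simp
  then show ?thesis
    by (simp add: complex_eq_iff norm_eq_sqrt_cinner cinner_self_nonneg)
qed

lemma norm_scaleC: "norm (a *\<^sub>C x) = cmod a * norm (x::'a::complex_inner)"
proof -
  have "cinner (a *\<^sub>C x) (a *\<^sub>C x) = (a * cnj a) * cinner x x"
    by (simp add: cinner_scaleC_left cinner_scaleC_right)
  also have "\<dots> = of_real ((cmod a)\<^sup>2 * (norm x)\<^sup>2)"
    by (simp add: cinner_self complex_norm_square flip: of_real_power)
  finally have "(norm (a *\<^sub>C x))\<^sup>2 = (cmod a * norm x)\<^sup>2"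
    unfolding cinner_self of_real_eq_iff by (simp add: power_mult_distrib)
  then show ?thesis
    by (simp add: power2_eq_iff_nonneg)
qed

lemma scaleC_minus_right: "a *\<^sub>C (- x) = - (a *\<^sub>C (x::'a::complex_inner))"
  by (metis scaleC_minus_one scaleC_scaleC mult.commute)

lemma scaleC_minus_left: "(- a) *\<^sub>C x = - (a *\<^sub>C (x::'a::complex_inner))"
  using scaleC_scaleC[of "-1" a x] by (simp add: scaleC_minus_one)

lemma scaleC_diff_right: "a *\<^sub>C (x - y) = a *\<^sub>C x - a *\<^sub>C (y::'a::complex_inner)"
  using scaleC_add_right[of a x "-y"] by (simp add: scaleC_minus_right)

section \<open>Operators determined by their quadratic forms\<close>

lemma cinner_polarization:
  fixes x y :: "'a::complex_inner"
  assumes "bounded_clinear B"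
  shows "4 * cinner (B x) y =
    cinner (B (x + y)) (x + y) - cinner (B (x - y)) (x - y)
    + \<i> * (cinner (B (x + \<i> *\<^sub>C y)) (x + \<i> *\<^sub>C y) - cinner (B (x - \<i> *\<^sub>C y)) (x - \<i> *\<^sub>C y))"
proof -
  interpret bounded_linear B
    using assms by (simp add: bounded_clinear_def)
  have "B (a *\<^sub>C z) = a *\<^sub>C B z" for a z
    using assms by (simp add: bounded_clinear_def)
  then show ?thesis
    by (simp add: add diff cinner_add_left cinner_add_right cinner_diff_left cinner_diff_right
        cinner_scaleC_left cinner_scaleC_right algebra_simps)
qed

lemma bounded_clinear_id: "bounded_clinear (\<lambda>x::'a::complex_inner. x)"
  by (simp add: bounded_clinear_def)

lemma parallelogram_law:
  fixes x y :: "'a::complex_inner"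
  shows "(norm (x + y))\<^sup>2 + (norm (x - y))\<^sup>2 = 2 * (norm x)\<^sup>2 + 2 * (norm y)\<^sup>2"
proof -
  have "complex_of_real ((norm (x + y))\<^sup>2 + (norm (x - y))\<^sup>2) =
      of_real (2 * (norm x)\<^sup>2 + 2 * (norm y)\<^sup>2)"
    unfolding of_real_add of_real_mult cinner_self[symmetric]
    by (simp add: cinner_add_left cinner_add_right cinner_diff_left cinner_diff_right)
  then show ?thesis
    using of_real_eq_iff by blast
qed

text \<open>An operator is controlled, up to a factor 2, by its numerical radius. This takes the place of
  the multiplicativity of the spectral integral, which is never needed below.\<close>

lemma norm_le_numerical_radius:
  fixes B :: "'a::complex_inner \<Rightarrow> 'a"
  assumes B: "bounded_clinear B" and m: "\<And>x. cmod (cinner (B x) x) \<le> m * (norm x)\<^sup>2"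
  shows "norm (B x) \<le> 2 * m * norm x"
proof (cases "B x = 0")
  case True
  have "0 \<le> m * (norm x)\<^sup>2"
    using m[of x] norm_ge_zero order_trans by blast
  then show ?thesis
    using True by (cases "x = 0") (auto simp: zero_le_mult_iff)
next
  case False
  then have x: "x \<noteq> 0"
    using B by (auto simp: bounded_clinear_def linear_simps)
  have bound: "4 * cmod (cinner (B x) y) \<le> 4 * m * ((norm x)\<^sup>2 + (norm y)\<^sup>2)" for y
  proof -
    let ?q = "\<lambda>z. cinner (B z) z"
    have "4 * cmod (cinner (B x) y) = cmod (4 * cinner (B x) y)"
      by (simp add: norm_mult)
    also have "\<dots> \<le> (cmod (?q (x + y)) + cmod (?q (x - y)))
        + (cmod (?q (x + \<i> *\<^sub>C y)) + cmod (?q (x - \<i> *\<^sub>C y)))"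
      unfolding cinner_polarization[OF B]
      by (intro norm_triangle_le add_mono norm_triangle_ineq4) (simp add: norm_mult norm_triangle_ineq4)
    also have "\<dots> \<le> m * ((norm (x + y))\<^sup>2 + (norm (x - y))\<^sup>2) +
        m * ((norm (x + \<i> *\<^sub>C y))\<^sup>2 + (norm (x - \<i> *\<^sub>C y))\<^sup>2)"
      unfolding distrib_left by (intro add_mono m)
    also have "\<dots> = 4 * m * ((norm x)\<^sup>2 + (norm y)\<^sup>2)"
      unfolding parallelogram_law by (simp add: norm_scaleC algebra_simps)
    finally show ?thesis .
  qed
  \<comment> \<open>This scaling gives \<open>r *\<^sub>R B x\<close> the norm of \<open>x\<close>,
    which balances the two squares in \<open>bound\<close>.\<close>
  define r where "r = norm x / norm (B x)"
  have "4 * (norm x * norm (B x)) = 4 * cmod (cinner (B x) (r *\<^sub>R B x))"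
    using False x by (simp add: cinner_scaleR_right cinner_self norm_mult norm_power r_def power2_eq_square)
  also have "\<dots> \<le> 4 * m * ((norm x)\<^sup>2 + (norm (r *\<^sub>R B x))\<^sup>2)"
    by (rule bound)
  also have "\<dots> = 4 * (norm x * (2 * m * norm x))"
    using False by (simp add: r_def power2_eq_square)
  finally show ?thesis
    using x by simp
qed

lemma bounded_clinear_diff:
  assumes "bounded_clinear A" "bounded_clinear B"
  shows "bounded_clinear (\<lambda>x. A x - B x)"
  using assms unfolding bounded_clinear_def
  by (auto intro: bounded_linear_sub simp: scaleC_diff_right)

lemma bounded_clinear_add:
  assumes "bounded_clinear A" "bounded_clinear B"
  shows "bounded_clinear (\<lambda>x. A x + B x)"
  using assms unfolding bounded_clinear_def
  by (auto intro: bounded_linear_add simp: scaleC_add_right)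

lemma bounded_clinear_compose:
  assumes "bounded_clinear A" "bounded_clinear B"
  shows "bounded_clinear (\<lambda>x. A (B x))"
  using assms unfolding bounded_clinear_def
  by (auto intro: bounded_linear_compose)

lemma bounded_clinear_scaleC:
  assumes "bounded_clinear A"
  shows "bounded_clinear (\<lambda>x. a *\<^sub>C A x)"
proof -
  have "bounded_linear (\<lambda>x::'b. a *\<^sub>C x)"
    by (rule bounded_linear_intro[where K="cmod a"])
      (simp_all add: scaleC_add_right norm_scaleC scaleC_scaleC mult.commute flip: scaleC_of_real)
  then show ?thesis
    using assms unfolding bounded_clinear_def
    by (simp add: bounded_linear_compose scaleC_scaleC mult.commute)
qed

text \<open>The difference has numerical radius 0. This is the uniqueness behind the
  \<open>THE\<close> in \<open>spectral_integral\<close>.\<close>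

lemma bounded_clinear_eqI:
  fixes A B :: "'a::complex_inner \<Rightarrow> 'a"
  assumes "bounded_clinear A" "bounded_clinear B" "\<And>x. cinner (A x) x = cinner (B x) x"
  shows "A = B"
  using norm_le_numerical_radius[OF bounded_clinear_diff[OF assms(1,2)], where m=0] assms(3)
  by (force simp: cinner_diff_left)

text \<open>Polarize \<open>A\<close> at \<open>(x, y)\<close> and \<open>B\<close> at
  \<open>(y, x)\<close>: the four arguments agree up to unimodular scalars, which quadratic forms
  ignore. Conjugating the integrand of a spectral integral therefore produces its adjoint.\<close>

lemma cinner_adjointI:
  fixes A B :: "'a::complex_inner \<Rightarrow> 'a"
  assumes A: "bounded_clinear A" and B: "bounded_clinear B"
    and eq: "\<And>x. cinner (A x) x = cnj (cinner (B x) x)"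
  shows "cinner (A x) y = cinner x (B y)"
proof -
  have *: "x - \<i> *\<^sub>C y = (- \<i>) *\<^sub>C (y + \<i> *\<^sub>C x)" "x + \<i> *\<^sub>C y = \<i> *\<^sub>C (y - \<i> *\<^sub>C x)"
    "x - y = - (y - x)" "x + y = y + x"
    by (simp_all add: scaleC_add_right scaleC_diff_right scaleC_minus_left scaleC_scaleC scaleC_one)
  have q: "cinner (B (a *\<^sub>C z)) (a *\<^sub>C z) = (a * cnj a) * cinner (B z) z" for a z
    using B by (simp add: bounded_clinear_def cinner_scaleC_left cinner_scaleC_right)
  have q': "cinner (B (- z)) (- z) = cinner (B z) z" for z
    using q[of "-1" z] by (simp add: scaleC_minus_one)
  define Q where "Q z = cinner (B z) z" for z
  have Q: "Q (x - y) = Q (y - x)" "Q (x + \<i> *\<^sub>C y) = Q (y - \<i> *\<^sub>C x)" "Q (x - \<i> *\<^sub>C y) = Q (y + \<i> *\<^sub>C x)"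
    unfolding * Q_def q q' by simp_all
  have "4 * cinner (A x) y = cnj (Q (x + y)) - cnj (Q (x - y))
      + \<i> * (cnj (Q (x + \<i> *\<^sub>C y)) - cnj (Q (x - \<i> *\<^sub>C y)))"
    unfolding Q_def by (simp only: cinner_polarization[OF A] eq)
  also have "\<dots> = cnj (Q (y + x) - Q (y - x) + \<i> * (Q (y + \<i> *\<^sub>C x) - Q (y - \<i> *\<^sub>C x)))"
    unfolding Q by (simp add: add.commute right_diff_distrib)
  also have "\<dots> = cnj (4 * cinner (B y) x)"
    unfolding Q_def by (simp only: cinner_polarization[OF B])
  finally show ?thesis
    using cinner_commute[of x "B y"] by simp
qed

lemma Cauchy_Schwarz: "cmod (cinner x y) \<le> norm x * norm (y::'a::complex_inner)"
proof (cases "y = 0")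
  case False
  define a where "a = cinner x y / of_real ((norm y)\<^sup>2)"
  have ne: "complex_of_real ((norm y)\<^sup>2) \<noteq> 0"
    using False by simp
  have "a * cinner y x = of_real ((cmod (cinner x y))\<^sup>2 / (norm y)\<^sup>2)"
    using complex_norm_square[of "cinner x y"] cinner_commute[of y x] by (simp add: a_def)
  moreover have "cinner (x - a *\<^sub>C y) (a *\<^sub>C y) = 0"
    using ne by (simp add: cinner_diff_left cinner_scaleC_left cinner_scaleC_right cinner_self a_def)
  ultimately have "complex_of_real ((norm (x - a *\<^sub>C y))\<^sup>2)
      = of_real ((norm x)\<^sup>2 - (cmod (cinner x y))\<^sup>2 / (norm y)\<^sup>2)"
    unfolding cinner_self[symmetric]
    by (simp add: cinner_diff_right) (simp add: cinner_diff_left cinner_scaleC_left cinner_self)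
  then have "0 \<le> (norm x)\<^sup>2 - (cmod (cinner x y))\<^sup>2 / (norm y)\<^sup>2"
    unfolding of_real_eq_iff by (metis zero_le_power2)
  then have "(cmod (cinner x y))\<^sup>2 \<le> (norm x * norm y)\<^sup>2"
    using False by (simp add: field_simps power_mult_distrib)
  then show ?thesis
    by (simp add: power2_le_iff_abs_le)
qed simp

lemma bounded_linear_cinner_left: "bounded_linear (\<lambda>x::'a::complex_inner. cinner x y)"
  by (rule bounded_linear_intro[where K="norm y"])
    (simp_all add: cinner_add_left cinner_scaleR_left scaleR_conv_of_real Cauchy_Schwarz)

section \<open>Spectral integrals of bounded Borel functions\<close>

locale spectral_pvm =
  fixes E :: "complex set \<Rightarrow> 'a::chilbert_space \<Rightarrow> 'a"
  assumes pvm: "projection_valued_measure E"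
begin

lemma E_proj: "S \<in> sets borel \<Longrightarrow> orthogonal_projection (E S)"
  and E_empty: "E {} = (\<lambda>x. 0)" and E_UNIV: "E UNIV = id"
  and E_Int: "S \<in> sets borel \<Longrightarrow> T \<in> sets borel \<Longrightarrow> E (S \<inter> T) = E S \<circ> E T"
  and E_sums: "range F \<subseteq> sets borel \<Longrightarrow> disjoint_family F \<Longrightarrow> (\<lambda>n::nat. E (F n) x) sums E (\<Union>n. F n) x"
  using pvm unfolding projection_valued_measure_def by auto

lemma E_clinear: "S \<in> sets borel \<Longrightarrow> bounded_clinear (E S)"
  using E_proj by (simp add: orthogonal_projection_def)

lemma E_self_adjoint: "S \<in> sets borel \<Longrightarrow> cinner (E S x) y = cinner x (E S y)"
  using E_proj by (simp add: orthogonal_projection_def)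

lemma E_E: "S \<in> sets borel \<Longrightarrow> T \<in> sets borel \<Longrightarrow> E S (E T x) = E (S \<inter> T) x"
  by (simp add: E_Int)

lemma cinner_E: "S \<in> sets borel \<Longrightarrow> cinner (E S x) x = of_real ((norm (E S x))\<^sup>2)"
  by (metis E_E E_self_adjoint Int_absorb cinner_self)

section \<open>Scalar measures and integrals against them\<close>

abbreviation \<mu> :: "'a \<Rightarrow> complex measure" where "\<mu> \<equiv> scalar_measure E"

lemma sets_scalar_measure [simp, measurable_cong]: "sets (\<mu> x) = sets borel"
  unfolding scalar_measure_def
  by (metis sets.sigma_sets_eq sets_measure_of space_borel sets.space_closed)

lemma space_scalar_measure [simp]: "space (\<mu> x) = UNIV"
  using sets_eq_imp_space_eq[OF sets_scalar_measure] by simp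

text \<open>Countable additivity is the strong convergence \<open>E_sums\<close> paired with
  \<open>x\<close>; the terms are squared norms, so the sum passes to
  \<open>ennreal\<close>.\<close>

lemma emeasure_scalar_measure:
  assumes "S \<in> sets borel"
  shows "emeasure (\<mu> x) S = ennreal ((norm (E S x))\<^sup>2)"
proof -
  have "emeasure (\<mu> x) S = ennreal (Re (cinner (E S x) x))"
  proof (rule emeasure_measure_of[OF scalar_measure_def])
    show "positive (sets (\<mu> x)) (\<lambda>S. ennreal (Re (cinner (E S x) x)))"
      by (simp add: positive_def E_empty)
    show "countably_additive (sets (\<mu> x)) (\<lambda>S. ennreal (Re (cinner (E S x) x)))"
    proof (rule countably_additiveI)
      fix F :: "nat \<Rightarrow> complex set"
      assume F: "range F \<subseteq> sets (\<mu> x)" "disjoint_family F" and U: "\<Union>(range F) \<in> sets (\<mu> x)"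
      have "(\<lambda>n. Re (cinner (E (F n) x) x)) sums Re (cinner (E (\<Union>(range F)) x) x)"
        using F by (intro sums_Re bounded_linear.sums[OF bounded_linear_cinner_left] E_sums) auto
      moreover have "F n \<in> sets borel" for n
        using F by auto
      ultimately have "(\<lambda>n. ennreal (Re (cinner (E (F n) x) x))) sums ennreal (Re (cinner (E (\<Union>(range F)) x) x))"
        using U by (simp add: cinner_E)
      then show "(\<Sum>n. ennreal (Re (cinner (E (F n) x) x))) = ennreal (Re (cinner (E (\<Union>(range F)) x) x))"
        by (simp add: sums_iff)
    qed
  qed (use assms in auto)
  then show ?thesis
    using assms by (simp add: cinner_E)
qed

lemma finite_scalar_measure: "finite_measure (\<mu> x)"
  by (rule finite_measureI) (simp add: emeasure_scalar_measure)

lemma measure_scalar_measure: "S \<in> sets borel \<Longrightarrow> measure (\<mu> x) S = (norm (E S x))\<^sup>2"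
  by (simp add: measure_def emeasure_scalar_measure)

lemma AE_in:
  assumes "S \<in> sets borel" "E S x = x"
  shows "AE z in \<mu> x. z \<in> S"
proof -
  have "E (- S) x = 0"
    using E_E[of "-S" S x] assms by (simp add: E_empty)
  then show ?thesis
    using assms by (intro AE_I[where N="- S"]) (auto simp: emeasure_scalar_measure)
qed

lemma integrable_bounded:
  assumes [measurable]: "h \<in> borel_measurable borel" and "\<And>z. cmod (h z) \<le> m"
  shows "integrable (\<mu> x) h"
proof -
  interpret finite_measure "\<mu> x" by (rule finite_scalar_measure)
  show ?thesis
    by (rule integrable_const_bound[where B=m]) (use assms in auto)
qed

lemma norm_integral_le:
  assumes "h \<in> borel_measurable borel" "\<And>z. cmod (h z) \<le> m"
  shows "cmod (\<integral>z. h z \<partial>\<mu> x) \<le> m * (norm x)\<^sup>2"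
proof -
  interpret finite_measure "\<mu> x" by (rule finite_scalar_measure)
  have "cmod (\<integral>z. h z \<partial>\<mu> x) \<le> (\<integral>z. m \<partial>\<mu> x)"
    by (rule Bochner_Integration.integral_norm_bound_integral) (use assms integrable_bounded[OF assms] in auto)
  also have "\<dots> = m * (norm x)\<^sup>2"
    by (simp add: measure_scalar_measure E_UNIV)
  finally show ?thesis .
qed

text \<open>A version of \<open>has_spectral_integral\<close> over the whole plane and without the
  integrability clause. It is applied to bounded Borel functions, for which
  \<open>integrable_bounded\<close> supplies that clause.\<close>

definition spec_int :: "(complex \<Rightarrow> complex) \<Rightarrow> ('a \<Rightarrow> 'a) \<Rightarrow> bool"
  where "spec_int h B \<longleftrightarrow> bounded_clinear B \<and> (\<forall>x. cinner (B x) x = (\<integral>z. h z \<partial>\<mu> x))"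

lemma spec_int_norm_le:
  assumes "spec_int h B" "h \<in> borel_measurable borel" "\<And>z. cmod (h z) \<le> m"
  shows "norm (B x) \<le> 2 * m * norm x"
  using assms norm_integral_le[OF assms(2,3)]
  by (intro norm_le_numerical_radius) (auto simp: spec_int_def)

lemma spec_int_add:
  assumes "spec_int h B" "spec_int k C"
    "h \<in> borel_measurable borel" "\<And>z. cmod (h z) \<le> m"
    "k \<in> borel_measurable borel" "\<And>z. cmod (k z) \<le> n"
  shows "spec_int (\<lambda>z. h z + k z) (\<lambda>x. B x + C x)"
  using assms integrable_bounded[OF assms(3,4)] integrable_bounded[OF assms(5,6)]
  by (auto simp: spec_int_def bounded_clinear_add cinner_add_left)

lemma spec_int_diff:
  assumes "spec_int h B" "spec_int k C"
    "h \<in> borel_measurable borel" "\<And>z. cmod (h z) \<le> m"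
    "k \<in> borel_measurable borel" "\<And>z. cmod (k z) \<le> n"
  shows "spec_int (\<lambda>z. h z - k z) (\<lambda>x. B x - C x)"
  using assms integrable_bounded[OF assms(3,4)] integrable_bounded[OF assms(5,6)]
  by (auto simp: spec_int_def bounded_clinear_diff cinner_diff_left)

lemma spec_int_scale:
  assumes "spec_int h B"
  shows "spec_int (\<lambda>z. a * h z) (\<lambda>x. a *\<^sub>C B x)"
  using assms by (auto simp: spec_int_def bounded_clinear_scaleC cinner_scaleC_left)

lemma spec_int_indicator:
  assumes "S \<in> sets borel"
  shows "spec_int (\<lambda>z. indicator S z) (E S)"
proof -
  interpret finite_measure "\<mu> x" for x by (rule finite_scalar_measure)
  have "indicator S = (\<lambda>z. complex_of_real (indicat_real S z))"
    by (auto simp: indicator_def)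
  then have "(\<integral>z. indicator S z \<partial>\<mu> x) = complex_of_real ((norm (E S x))\<^sup>2)" for x
    using assms measure_scalar_measure[OF assms, of x] by simp
  then show ?thesis
    using assms by (simp add: spec_int_def E_clinear cinner_E)
qed

lemma spec_int_sum:
  assumes "finite J" "\<And>j. j \<in> J \<Longrightarrow> S j \<in> sets borel"
  shows "\<exists>B. spec_int (\<lambda>z. \<Sum>j\<in>J. a j * indicator (S j) z) B"
  using assms
proof (induction J rule: finite_induct)
  case empty
  have "spec_int (\<lambda>z. 0) (\<lambda>x. 0)"
    by (simp add: spec_int_def bounded_clinear_def flip: scaleC_of_real)
       (metis cinner_scaleC_left mult_zero_left norm_zero norm_scaleC cinner_zero_left norm_eq_zero mult_zero_right)
  then show ?case
    by auto
next
  case (insert j J)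
  then obtain B where "spec_int (\<lambda>z. \<Sum>j\<in>J. a j * indicator (S j) z) B"
    by auto
  moreover have "spec_int (\<lambda>z. a j * indicator (S j) z) (\<lambda>x. a j *\<^sub>C E (S j) x)"
    using insert by (intro spec_int_scale spec_int_indicator) auto
  moreover have "cmod (\<Sum>j\<in>J. a j * indicator (S j) z) \<le> (\<Sum>j\<in>J. cmod (a j))" for z
    by (intro norm_sum[THEN order_trans] sum_mono) (auto simp: norm_mult indicator_def)
  moreover have "cmod (a j * indicator (S j) z) \<le> cmod (a j)" for z
    by (auto simp: indicator_def)
  moreover have [measurable]: "S i \<in> sets borel" if "i = j \<or> i \<in> J" for i
    using that insert by auto
  ultimately have "spec_int (\<lambda>z. a j * indicator (S j) z + (\<Sum>j\<in>J. a j * indicator (S j) z)) (\<lambda>x. a j *\<^sub>C E (S j) x + B x)"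
    by (intro spec_int_add borel_measurable_sum borel_measurable_times) auto
  then show ?case
    unfolding sum.insert[OF insert(1,2)] by blast
qed

text \<open>Completeness of the space enters here. Differences of the approximants are spectral
  integrals of uniformly small functions, so the operators are Cauchy at each vector; the quadratic
  forms converge along with the integrals.\<close>

lemma spec_int_uniform_limit:
  assumes h [measurable]: "\<And>n. h n \<in> borel_measurable borel" "k \<in> borel_measurable borel"
    and k: "\<And>z. cmod (k z) \<le> m"
    and hk: "\<And>n z. cmod (h n z - k z) \<le> e n" and e: "e \<longlonglongrightarrow> 0"
    and B: "\<And>n. spec_int (h n) (B n)"
  shows "\<exists>C. spec_int k C"
proof -
  have hb: "cmod (h n z) \<le> m + e n" for n z
    using norm_triangle_ineq2[of "h n z" "k z"] hk[of n z] k[of z] by linarith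
  have dB: "norm (B n x - B p x) \<le> 2 * (e n + e p) * norm x" for n p x
  proof (rule spec_int_norm_le[OF spec_int_diff[OF B B h(1) hb h(1) hb]])
    fix z
    show "cmod (h n z - h p z) \<le> e n + e p"
      using norm_triangle_ineq4[of "h n z - k z" "h p z - k z"] hk[of n z] hk[of p z] by simp
  qed measurable
  have "Cauchy (\<lambda>n. B n x)" for x
  proof (rule metric_CauchyI)
    fix r :: real assume "r > 0"
    have "(\<lambda>n. 4 * e n * norm x) \<longlonglongrightarrow> 4 * 0 * norm x"
      by (intro tendsto_intros e)
    then obtain N where N: "\<And>n. n \<ge> N \<Longrightarrow> 4 * e n * norm x < r"
      using \<open>r > 0\<close> by (metis (no_types, lifting) order_tendstoD(2) eventually_sequentially mult_zero_left mult_zero_right)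
    have "dist (B n x) (B p x) < r" if "n \<ge> N" "p \<ge> N" for n p
      using dB[of n x p] N[OF that(1)] N[OF that(2)] by (simp add: dist_norm algebra_simps)
    then show "\<exists>N. \<forall>n\<ge>N. \<forall>p\<ge>N. dist (B n x) (B p x) < r"
      by blast
  qed
  then have "\<forall>x. \<exists>y. (\<lambda>n. B n x) \<longlonglongrightarrow> y"
    by (simp add: Cauchy_convergent_iff convergent_def)
  from choice[OF this] obtain C where C: "\<And>x. (\<lambda>n. B n x) \<longlonglongrightarrow> C x"
    by blast
  have Bb: "bounded_clinear (B n)" for n
    using B by (simp add: spec_int_def)
  then interpret Bn: bounded_linear "B n" for n
    by (simp add: bounded_clinear_def)
  have cts: "bounded_linear (\<lambda>x::'a. a *\<^sub>C x)" for a
    using bounded_clinear_scaleC[OF bounded_clinear_id] by (auto simp: bounded_clinear_def)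
  have Cc: "C (a *\<^sub>C x) = a *\<^sub>C C x" for a x
  proof (rule LIMSEQ_unique[OF C])
    show "(\<lambda>n. B n (a *\<^sub>C x)) \<longlonglongrightarrow> a *\<^sub>C C x"
      using bounded_linear.tendsto[OF cts C] Bb by (simp add: bounded_clinear_def)
  qed
  have Cadd: "C (x + y) = C x + C y" for x y
  proof (rule LIMSEQ_unique[OF C])
    show "(\<lambda>n. B n (x + y)) \<longlonglongrightarrow> C x + C y"
      using tendsto_add[OF C C] by (simp add: Bn.add)
  qed
  \<comment> \<open>The bounds on \<open>B n\<close> vary with \<open>n\<close>; in the limit they
    leave \<open>2 * m\<close> as a bound for \<open>C\<close>.\<close>
  have "(\<lambda>n. norm (B n x)) \<longlonglongrightarrow> norm (C x)" "(\<lambda>n. 2 * (m + e n) * norm x) \<longlonglongrightarrow> 2 * (m + 0) * norm x" for x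
    by (intro tendsto_intros C e)+
  from LIMSEQ_le[OF this] have "norm (C x) \<le> 2 * (m + 0) * norm x" for x
    using spec_int_norm_le[OF B h(1) hb] by auto
  then have "bounded_clinear C"
    unfolding bounded_clinear_def using Cc Cadd
    by (auto intro!: bounded_linear_intro[where K="2 * m"] simp: mult.commute simp flip: scaleC_of_real)
  moreover have "cinner (C x) x = (\<integral>z. k z \<partial>\<mu> x)" for x
  proof (rule LIMSEQ_unique)
    show "(\<lambda>n. cinner (B n x) x) \<longlonglongrightarrow> cinner (C x) x"
      by (intro bounded_linear.tendsto[OF bounded_linear_cinner_left] C)
    have bound: "norm (cinner (B n x) x - (\<integral>z. k z \<partial>\<mu> x)) \<le> e n * (norm x)\<^sup>2" for n
      using B[of n] norm_integral_le[of "\<lambda>z. h n z - k z", OF _ hk]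
      by (simp add: spec_int_def integrable_bounded[OF h(1) hb] integrable_bounded[OF h(2) k])
    have "(\<lambda>n. e n * (norm x)\<^sup>2) \<longlonglongrightarrow> 0"
      using tendsto_mult_left_zero[OF e] .
    then have "(\<lambda>n. cinner (B n x) x - (\<integral>z. k z \<partial>\<mu> x)) \<longlonglongrightarrow> 0"
      by (rule Lim_null_comparison[OF always_eventually[OF allI[OF bound]]])
    then show "(\<lambda>n. cinner (B n x) x) \<longlonglongrightarrow> (\<integral>z. k z \<partial>\<mu> x)"
      by (rule LIM_zero_cancel)
  qed
  ultimately have "spec_int k C"
    by (simp add: spec_int_def)
  then show ?thesis by (rule exI[where x=C])
qed

end

section \<open>Existence and adjoints of bounded spectral integrals\<close>

context spectral_pvm
begin

lemma spec_int_exists_real: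
  assumes [measurable]: "h \<in> borel_measurable borel" and m: "\<And>z. \<bar>h z\<bar> \<le> m"
  shows "\<exists>B. spec_int (\<lambda>z. of_real (h z)) B"
proof -
  \<comment> \<open>\<open>k n\<close> rounds \<open>h\<close> down to multiples of
    \<open>1 / Suc n\<close>. Since \<open>h\<close> is bounded by \<open>m\<close>, the levels lie
    between \<open>- N n\<close> and \<open>N n\<close>, so \<open>k n\<close> is a finite
    combination of indicators.\<close>
  define N where "N n = \<lceil>real (Suc n) * m\<rceil> + 1" for n
  define S where "S n j = {z. \<lfloor>real (Suc n) * h z\<rfloor> = j}" for n and j :: int
  define k where "k n z = (\<Sum>j\<in>{- N n..N n}. complex_of_real (of_int j / real (Suc n)) * indicator (S n j) z)" for n z
  have S [measurable]: "S n j \<in> sets borel" for n j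
    unfolding S_def by measurable
  have k: "k n z = of_real (of_int \<lfloor>real (Suc n) * h z\<rfloor> / real (Suc n))" for n z
  proof -
    have "\<bar>real (Suc n) * h z\<bar> \<le> real (Suc n) * m"
      unfolding abs_mult using m[of z] by (intro mult_mono) auto
    then have "\<lfloor>real (Suc n) * h z\<rfloor> \<in> {- N n..N n}"
      unfolding N_def atLeastAtMost_iff by linarith
    moreover have "k n z = (\<Sum>j\<in>{- N n..N n}. if j = \<lfloor>real (Suc n) * h z\<rfloor> then
        of_real (of_int \<lfloor>real (Suc n) * h z\<rfloor> / real (Suc n)) else 0)"
      unfolding k_def by (intro sum.cong) (auto simp: S_def indicator_def)
    ultimately show ?thesis
      by simp
  qed
  have "\<exists>B. spec_int (k n) B" for n
    unfolding k_def[abs_def] by (intro spec_int_sum S) simp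
  then have "\<forall>n. \<exists>B. spec_int (k n) B"
    by blast
  from choice[OF this] obtain B where B: "\<And>n. spec_int (k n) (B n)"
    by blast
  show ?thesis
  proof (rule spec_int_uniform_limit[OF _ _ _ _ _ B])
    show "k n \<in> borel_measurable borel" for n
      unfolding k_def[abs_def] by measurable
    show "(\<lambda>z. complex_of_real (h z)) \<in> borel_measurable borel"
      by measurable
    show "cmod (of_real (h z)) \<le> m" for z
      using m by simp
    show "(\<lambda>n. 1 / real (Suc n)) \<longlonglongrightarrow> 0"
      using LIMSEQ_inverse_real_of_nat by (simp add: inverse_eq_divide)
    show "cmod (k n z - of_real (h z)) \<le> 1 / real (Suc n)" for n z
    proof -
      define w where "w = real (Suc n) * h z"
      have "k n z - of_real (h z) = of_real ((of_int \<lfloor>w\<rfloor> - w) / real (Suc n))"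
        by (simp add: k w_def diff_divide_distrib del: of_nat_Suc)
      also have "cmod \<dots> \<le> 1 / real (Suc n)"
        unfolding norm_of_real abs_divide by (intro frac_le) linarith+
      finally show ?thesis .
    qed
  qed
qed

lemma spec_int_exists:
  assumes [measurable]: "h \<in> borel_measurable borel" and m: "\<And>z. cmod (h z) \<le> m"
  shows "\<exists>B. spec_int h B"
proof -
  have Re: "\<bar>Re (h z)\<bar> \<le> m" and Im: "\<bar>Im (h z)\<bar> \<le> m" for z
    using m[of z] abs_Re_le_cmod[of "h z"] abs_Im_le_cmod[of "h z"] by linarith+
  obtain B where B: "spec_int (\<lambda>z. of_real (Re (h z))) B"
    using spec_int_exists_real[of "\<lambda>z. Re (h z)", OF _ Re] by auto
  obtain C where C: "spec_int (\<lambda>z. of_real (Im (h z))) C"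
    using spec_int_exists_real[of "\<lambda>z. Im (h z)", OF _ Im] by auto
  have "spec_int (\<lambda>z. of_real (Re (h z)) + \<i> * of_real (Im (h z))) (\<lambda>x. B x + \<i> *\<^sub>C C x)"
    by (rule spec_int_add[OF B spec_int_scale[OF C]]) (use Re Im in \<open>auto simp: norm_mult\<close>)
  then show ?thesis
    unfolding complex_eq[symmetric] by blast
qed

text \<open>The vector \<open>u\<close> is the spectral integral of the conjugate function applied
  to \<open>f\<close>. The adjoint is stated one vector at a time because it is used by putting
  \<open>u\<close> in place of \<open>f\<close> in the Bessel bound.\<close>

lemma spec_int_adjoint:
  assumes B: "spec_int h B" and h: "h \<in> borel_measurable borel" and m: "\<And>z. cmod (h z) \<le> m"
  shows "\<exists>u. norm u \<le> 2 * m * norm f \<and> (\<forall>g. cinner f (B g) = cinner u g)"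
proof -
  have h': "(\<lambda>z. cnj (h z)) \<in> borel_measurable borel" "\<And>z. cmod (cnj (h z)) \<le> m"
    using h m by (auto intro: borel_measurable_continuous_on continuous_intros)
  obtain C where C: "spec_int (\<lambda>z. cnj (h z)) C"
    using spec_int_exists[OF h'] by blast
  have "cinner (C x) y = cinner x (B y)" for x y
    using B C by (intro cinner_adjointI) (auto simp: spec_int_def)
  then show ?thesis
    using spec_int_norm_le[OF C h'] by (metis (no_types))
qed

end

section \<open>Support of the spectral measure\<close>

locale spectral_op = spectral_pvm E for E :: "complex set \<Rightarrow> 'a::chilbert_space \<Rightarrow> 'a" +
  fixes A :: "'a \<Rightarrow> 'a"
  assumes A: "spectral_measure_of A E"
begin

lemma A_clinear: "bounded_clinear A"
  using A by (simp add: spectral_measure_of_def has_spectral_integral_def)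

text \<open>Integrability includes measurability, even for the zero measure \<open>\<mu> 0\<close>.
  The identity cut off to the spectrum is nonzero exactly on \<open>spectrum A - {0}\<close>; the
  point 0 is put back by hand.\<close>

lemma spectrum_borel [measurable]: "spectrum A \<in> sets borel"
proof -
  have "set_integrable (\<mu> 0) (spectrum A) (\<lambda>z. z)"
    using A by (simp add: spectral_measure_of_def has_spectral_integral_def)
  then have [measurable]: "(\<lambda>z. indicat_real (spectrum A) z *\<^sub>R z) \<in> borel_measurable borel"
    unfolding set_integrable_def by (auto dest: borel_measurable_integrable)
  have "{z \<in> space borel. indicat_real (spectrum A) z *\<^sub>R z \<noteq> 0} \<in> sets borel"
    by measurable
  also have "{z \<in> space borel. indicat_real (spectrum A) z *\<^sub>R z \<noteq> 0} = spectrum A - {0}"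
    by (auto simp: indicator_def)
  finally have "spectrum A - {0} \<in> sets borel" .
  then have "(spectrum A - {0}) \<union> (if 0 \<in> spectrum A then {0} else {}) \<in> sets borel"
    by (intro sets.Un) auto
  also have "(spectrum A - {0}) \<union> (if 0 \<in> spectrum A then {0} else {}) = spectrum A"
    by auto
  finally show ?thesis .
qed

lemma AE_spectrum: "AE z in \<mu> x. z \<in> spectrum A"
  using A by (intro AE_in) (auto simp: spectral_measure_of_def)

lemma integrable_identity: "integrable (\<mu> x) (\<lambda>z. z)"
  and quadratic_form: "cinner (A x) x = (\<integral>z. z \<partial>\<mu> x)"
proof -
  have int: "integrable (\<mu> x) (\<lambda>z. indicat_real (spectrum A) z *\<^sub>R z)"
    and eq: "cinner (A x) x = (\<integral>z. indicat_real (spectrum A) z *\<^sub>R z \<partial>\<mu> x)"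
    using A by (auto simp: spectral_measure_of_def has_spectral_integral_def set_integrable_def set_lebesgue_integral_def)
  have AE: "AE z in \<mu> x. indicat_real (spectrum A) z *\<^sub>R z = z"
    using AE_spectrum by eventually_elim simp
  show "integrable (\<mu> x) (\<lambda>z. z)"
    by (rule integrable_cong_AE_imp[OF int _ AE]) simp
  show "cinner (A x) x = (\<integral>z. z \<partial>\<mu> x)"
    unfolding eq by (rule integral_cong_AE[OF _ _ AE]) auto
qed

text \<open>The hypothesis is applied to \<open>E S x\<close>, which \<open>E S\<close> fixes.
  Claims about the support thus reduce to one vector in the range of a spectral projection.\<close>

lemma AE_not_in:
  assumes "S \<in> sets borel" "\<And>x. E S x = x \<Longrightarrow> x = 0"
  shows "AE z in \<mu> x. z \<notin> S"
proof -
  have "E S (E S x) = E S x"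
    using E_E[of S S x] assms(1) by simp
  then have "E S x = 0"
    by (rule assms(2))
  then show ?thesis
    using assms(1) by (intro AE_I[where N=S]) (auto simp: emeasure_scalar_measure)
qed

text \<open>On a vector fixed by the projection of the far half plane, the form of \<open>u\<close>
  times \<open>A\<close> has real part at least \<open>(M + 1) * (norm x)\<^sup>2\<close>. The
  numerical radius \<open>M\<close> permits this only for \<open>x = 0\<close>; the extra 1 is the
  margin.\<close>

lemma AE_halfplane:
  assumes M: "\<And>x. cmod (cinner (A x) x) \<le> M * (norm x)\<^sup>2" and u: "cmod u = 1"
  shows "AE z in \<mu> x. Re (u * z) \<le> M + 1"
proof -
  define S where "S = {z. M + 1 \<le> Re (u * z)}"
  have [measurable]: "S \<in> sets borel"
    unfolding S_def by measurable
  have "x = 0" if x: "E S x = x" for x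
  proof -
    interpret finite_measure "\<mu> x" by (rule finite_scalar_measure)
    have AE: "AE z in \<mu> x. M + 1 \<le> Re (u * z)"
      using AE_in[OF _ x] by (simp add: S_def)
    have int: "integrable (\<mu> x) (\<lambda>z. u * z)"
      using integrable_identity by simp
    have "(M + 1) * (norm x)\<^sup>2 = (\<integral>z. M + 1 \<partial>\<mu> x)"
      by (simp add: measure_scalar_measure E_UNIV)
    also have "\<dots> \<le> (\<integral>z. Re (u * z) \<partial>\<mu> x)"
      using AE int by (intro integral_mono_AE integrable_Re) auto
    also have "\<dots> = Re (u * cinner (A x) x)"
      using integral_Re[OF int] by (simp add: quadratic_form)
    also have "\<dots> \<le> cmod (cinner (A x) x)"
      using complex_Re_le_cmod[of "u * cinner (A x) x"] u by (simp add: norm_mult)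
    finally have "M * (norm x)\<^sup>2 + (norm x)\<^sup>2 \<le> cmod (cinner (A x) x)"
      by (simp add: distrib_right)
    with M[of x] have "(norm x)\<^sup>2 \<le> 0"
      by linarith
    then show "x = 0"
      by simp
  qed
  then have "AE z in \<mu> x. z \<notin> S"
    by (intro AE_not_in) auto
  then show ?thesis
    by eventually_elim (simp add: S_def)
qed

lemma AE_bounded: "\<exists>M\<ge>1. \<forall>x. AE z in \<mu> x. cmod z \<le> M"
proof -
  obtain M where M: "0 < M" "\<And>x. norm (A x) \<le> norm x * M"
    using A_clinear by (auto simp: bounded_clinear_def dest: bounded_linear.pos_bounded)
  have q: "cmod (cinner (A x) x) \<le> M * (norm x)\<^sup>2" for x
    using order_trans[OF Cauchy_Schwarz mult_right_mono[OF M(2)]] by (simp add: power2_eq_square mult_ac)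
  have "AE z in \<mu> x. cmod z \<le> 2 * (M + 1)" for x
  proof -
    \<comment> \<open>The directions 1, -1, \<open>\<i>\<close>, \<open>-\<i>\<close> give four half
      planes that enclose a square.\<close>
    have 1: "AE z in \<mu> x. Re z \<le> M + 1" and 2: "AE z in \<mu> x. - Re z \<le> M + 1"
      and 3: "AE z in \<mu> x. - Im z \<le> M + 1" and 4: "AE z in \<mu> x. Im z \<le> M + 1"
      using AE_halfplane[OF q, of 1 x] AE_halfplane[OF q, of "-1" x]
        AE_halfplane[OF q, of "\<i>" x] AE_halfplane[OF q, of "-\<i>" x] by simp_all
    from 1 2 3 4 show ?thesis
    proof eventually_elim
      case (elim z)
      then have "\<bar>Re z\<bar> \<le> M + 1" "\<bar>Im z\<bar> \<le> M + 1"
        by (simp_all add: abs_le_iff)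
      then show ?case
        using order_trans[OF cmod_le add_mono, of z "M + 1" "M + 1"] by simp
    qed
  qed
  then show ?thesis
    using M(1) by (intro exI[of _ "2 * (M + 1)"]) auto
qed

text \<open>The scalar measure of \<open>E T x\<close> is that of \<open>x\<close> restricted to
  \<open>T\<close>, so the integral over the plane splits along \<open>S\<close> and its
  complement.\<close>

lemma cinner_split:
  assumes S: "S \<in> sets borel"
  shows "cinner (A x) x = cinner (A (E S x)) (E S x) + cinner (A (E (- S) x)) (E (- S) x)"
proof -
  have restrict: "(\<integral>z. indicat_real T z *\<^sub>R z \<partial>\<mu> x) = cinner (A (E T x)) (E T x)"
    if [measurable]: "T \<in> sets borel" for T
  proof -
    have "\<mu> (E T x) = density (\<mu> x) (\<lambda>z. ennreal (indicat_real T z))"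
    proof (rule measure_eqI)
      fix U assume "U \<in> sets (\<mu> (E T x))"
      then have [measurable]: "U \<in> sets borel"
        by simp
      have "emeasure (density (\<mu> x) (\<lambda>z. ennreal (indicat_real T z))) U = emeasure (\<mu> x) (T \<inter> U)"
        by (simp add: emeasure_restricted ennreal_indicator)
      then show "emeasure (\<mu> (E T x)) U = emeasure (density (\<mu> x) (\<lambda>z. ennreal (indicat_real T z))) U"
        by (simp add: emeasure_scalar_measure E_E Int_commute)
    qed simp
    then have "(\<integral>z. z \<partial>\<mu> (E T x)) = (\<integral>z. indicat_real T z *\<^sub>R z \<partial>\<mu> x)"
      by (simp add: integral_density)
    then show ?thesis
      by (simp add: quadratic_form)
  qed
  have "cinner (A x) x = (\<integral>z. indicat_real S z *\<^sub>R z + indicat_real (- S) z *\<^sub>R z \<partial>\<mu> x)"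
    unfolding quadratic_form by (intro Bochner_Integration.integral_cong) (auto simp: indicator_def)
  also have "\<dots> = (\<integral>z. indicat_real S z *\<^sub>R z \<partial>\<mu> x) + (\<integral>z. indicat_real (- S) z *\<^sub>R z \<partial>\<mu> x)"
    using S by (intro Bochner_Integration.integral_add integrable_mult_indicator integrable_identity) auto
  finally show ?thesis
    using S by (simp add: restrict)
qed

text \<open>By \<open>cinner_split\<close> the mixed terms of the form at \<open>x + w\<close>
  cancel each other. Taking \<open>w = y\<close> and \<open>w = \<i> *\<^sub>C y\<close> makes their
  sum and their difference vanish, hence each of them. This yields invariance of the range of
  \<open>E S\<close> under \<open>A\<close> from the quadratic form alone.\<close>

lemma cinner_complement:
  assumes S: "S \<in> sets borel" and x: "E S x = x" and y: "E (- S) y = y"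
  shows "cinner (A x) y = 0"
proof -
  have S': "- S \<in> sets borel"
    using S by auto
  interpret A: bounded_linear A
    using A_clinear by (simp add: bounded_clinear_def)
  interpret ES: bounded_linear "E S"
    using E_clinear[OF S] by (simp add: bounded_clinear_def)
  interpret ES': bounded_linear "E (- S)"
    using E_clinear[OF S'] by (simp add: bounded_clinear_def)
  have additive: "cinner (A x) w + cinner (A w) x = 0" if w: "E (- S) w = w" for w
  proof -
    have "E (- S) x = 0" "E S w = 0"
      using E_E[OF S' S, of x] E_E[OF S S', of w] by (simp_all add: x w E_empty)
    then have "cinner (A (x + w)) (x + w) = cinner (A x) x + cinner (A w) w"
      using cinner_split[OF S, of "x + w"] by (simp add: ES.add ES'.add x w)
    then show ?thesis
      by (simp add: A.add cinner_add_left cinner_add_right add.commute)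
  qed
  have "E (- S) (\<i> *\<^sub>C y) = \<i> *\<^sub>C y"
    using E_clinear[OF S'] by (simp add: bounded_clinear_def y)
  from additive[OF this] have "\<i> * (cinner (A y) x - cinner (A x) y) = 0"
    using A_clinear by (simp add: bounded_clinear_def cinner_scaleC_left cinner_scaleC_right algebra_simps)
  then show ?thesis
    using additive[OF y] by simp
qed

text \<open>On the range of the projection of a small disc, \<open>A\<close> contracts by
  \<open>2 * r\<close>, while a left inverse bounded by \<open>b\<close> forbids contraction below
  \<open>1 / b\<close>.\<close>

lemma AE_bounded_below:
  assumes "invertible_operator A"
  shows "\<exists>r>0. \<forall>x. AE z in \<mu> x. r \<le> cmod z"
proof -
  obtain B where B: "bounded_clinear B" "B \<circ> A = id"
    using assms by (auto simp: invertible_operator_def)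
  then obtain b where b: "0 < b" "\<And>x. norm (B x) \<le> norm x * b"
    by (auto simp: bounded_clinear_def dest: bounded_linear.pos_bounded)
  \<comment> \<open>Chosen so that \<open>2 * r * b = 1 / 2\<close>, where the 2 comes from the
    numerical radius.\<close>
  define r where "r = 1 / (4 * b)"
  define S where "S = {z. cmod z < r}"
  have S: "S \<in> sets borel"
    unfolding S_def by measurable
  then have S': "- S \<in> sets borel"
    by auto
  have "x = 0" if x: "E S x = x" for x
  proof -
    \<comment> \<open>The numerical radius has to be bounded on all vectors, hence the compression
      of \<open>A\<close> by \<open>E S\<close> on both sides.\<close>
    have num: "cmod (cinner (E S (A (E S y))) y) \<le> r * (norm y)\<^sup>2" for y
    proof -
      interpret finite_measure "\<mu> (E S y)" by (rule finite_scalar_measure)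
      have "E S (E S y) = E S y"
        using E_E[OF S S, of y] by simp
      from AE_in[OF S this] have AE: "AE z in \<mu> (E S y). cmod z \<le> r"
        by eventually_elim (simp add: S_def)
      have "cmod (cinner (E S (A (E S y))) y) = cmod (\<integral>z. z \<partial>\<mu> (E S y))"
        by (simp add: E_self_adjoint[OF S] quadratic_form)
      also have "\<dots> \<le> (\<integral>z. r \<partial>\<mu> (E S y))"
        by (intro order_trans[OF integral_norm_bound] integral_mono_AE AE integrable_norm integrable_identity) simp
      also have "\<dots> = r * (norm (E S y))\<^sup>2"
        by (simp add: measure_scalar_measure E_UNIV)
      also have "\<dots> \<le> r * (norm y)\<^sup>2"
      proof -
        have "(norm (E S y))\<^sup>2 \<le> (norm y)\<^sup>2"
          using finite_measure.bounded_measure[OF finite_scalar_measure, of y S]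
          by (simp add: measure_scalar_measure S E_UNIV)
        then show ?thesis
          using b by (simp add: r_def divide_right_mono)
      qed
      finally show ?thesis .
    qed
    have clin: "bounded_clinear (\<lambda>y. E S (A (E S y)))"
      using bounded_clinear_compose[OF E_clinear[OF S] bounded_clinear_compose[OF A_clinear E_clinear[OF S]]] .
    have "E (- S) (A x) = 0"
    proof -
      have "E (- S) (E (- S) (A x)) = E (- S) (A x)"
        using E_E[OF S' S', of "A x"] by simp
      from cinner_complement[OF S x this] have "cinner (E (- S) (A x)) (A x) = 0"
        using E_self_adjoint[OF S'] cinner_commute by (metis complex_cnj_zero)
      then show ?thesis
        using cinner_E[OF S', of "A x"] by simp
    qed
    \<comment> \<open>Pythagoras, read as additivity of the scalar measure of \<open>A x\<close> on
      \<open>S\<close> and its complement.\<close>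
    then have "norm (A x) = norm (E S (A x))"
      using finite_measure.finite_measure_compl[OF finite_scalar_measure, of S "A x"]
      by (simp add: measure_scalar_measure S S' E_UNIV flip: Compl_eq_Diff_UNIV)
    then have "norm (A x) \<le> 2 * r * norm x"
      using norm_le_numerical_radius[OF clin num, of x] by (simp add: x)
    moreover have "norm x \<le> norm (A x) * b"
      using b(2)[of "A x"] B(2) by (simp add: fun_eq_iff)
    ultimately have "norm x \<le> (2 * r * norm x) * b"
      using b(1) by (meson mult_right_mono less_imp_le order_trans)
    then show "x = 0"
      using b(1) by (simp add: r_def)
  qed
  from AE_not_in[OF S this] have "AE z in \<mu> x. r \<le> cmod z" for x
    by (auto simp: S_def not_less)
  moreover have "r > 0"
    using b by (simp add: r_def)
  ultimately show ?thesis
    by blast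
qed

end

section \<open>Continuous powers\<close>

lemma cpower_eq: "z \<noteq> 0 \<Longrightarrow> cpower z t = of_real (cmod z powr t) * exp (\<i> * of_real (t * arg_lower z))"
  by (simp add: cpower_def powr_def distrib_left exp_add mult.left_commute flip: exp_of_real)

lemma norm_cpower: "z \<noteq> 0 \<Longrightarrow> cmod (cpower z t) = cmod z powr t"
  by (simp add: cpower_eq norm_mult)

lemma norm_exp_ii_diff_le: "cmod (exp (\<i> * of_real a) - exp (\<i> * of_real b)) \<le> \<bar>a - b\<bar>"
proof -
  have "exp (\<i> * of_real a) - exp (\<i> * of_real b) = exp (\<i> * of_real b) * (exp (\<i> * of_real (a - b)) - 1)"
    by (simp add: algebra_simps flip: exp_add)
  then have "cmod (exp (\<i> * of_real a) - exp (\<i> * of_real b)) = 2 * \<bar>sin ((a - b) / 2)\<bar>"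
    using dist_exp_i_1[of "a - b"] by (simp add: norm_mult)
  then show ?thesis
    using abs_sin_x_le_abs_x[of "(a - b) / 2"] by simp
qed

lemma norm_cpower_diff_le:
  assumes "z \<noteq> 0"
  shows "cmod (cpower z t - cpower z s) \<le> \<bar>cmod z powr t - cmod z powr s\<bar> + cmod z powr s * (pi * \<bar>t - s\<bar>)"
proof -
  let ?e = "\<lambda>t. exp (\<i> * of_real (t * arg_lower z))"
  have "cpower z t - cpower z s = of_real (cmod z powr t - cmod z powr s) * ?e t
      + of_real (cmod z powr s) * (?e t - ?e s)"
    using assms by (simp add: cpower_eq algebra_simps)
  also have "cmod \<dots> \<le> \<bar>cmod z powr t - cmod z powr s\<bar> + cmod z powr s * cmod (?e t - ?e s)"
    by (rule norm_triangle_le) (simp add: norm_mult)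
  also have "cmod (?e t - ?e s) \<le> pi * \<bar>t - s\<bar>"
  proof -
    have "cmod (?e t - ?e s) \<le> \<bar>t * arg_lower z - s * arg_lower z\<bar>"
      by (rule norm_exp_ii_diff_le)
    also have "\<dots> = \<bar>arg_lower z\<bar> * \<bar>t - s\<bar>"
      by (simp add: abs_mult[symmetric] algebra_simps)
    also have "\<dots> \<le> pi * \<bar>t - s\<bar>"
      using arg_lower_bounds[of z] by (intro mult_right_mono) auto
    finally show ?thesis .
  qed
  finally show ?thesis
    by (simp add: mult_left_mono)
qed

lemma norm_cpower_le:
  assumes "cmod z \<le> M" "1 \<le> M" "0 \<le> t" "t \<le> L"
  shows "cmod (cpower z t) \<le> M powr L"
proof (cases "z = 0")
  case True
  then show ?thesis
    using assms ge_one_powr_ge_zero[of M L] by (auto simp: cpower_def)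
next
  case False
  then have "cmod (cpower z t) \<le> M powr t"
    using assms by (simp add: norm_cpower powr_mono2)
  also have "\<dots> \<le> M powr L"
    using assms by (simp add: powr_mono)
  finally show ?thesis .
qed

text \<open>The argument is discontinuous in \<open>z\<close> but it is bounded, so it does not affect the
  equicontinuity in \<open>t\<close>.\<close>

lemma cpower_uniformly_continuous:
  assumes "0 \<le> r" "0 \<le> a" "0 < r \<or> 0 < a" "0 < e"
  shows "\<exists>d>0. \<forall>t\<in>{a..L}. \<forall>s\<in>{a..L}. \<bar>t - s\<bar> < d \<longrightarrow>
    (\<forall>z. r \<le> cmod z \<and> cmod z \<le> M \<longrightarrow> cmod (cpower z t - cpower z s) < e)"
proof -
  define N where "N = max M 1 powr \<bar>L\<bar>"
  have N: "N > 0"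
    by (simp add: N_def)
  \<comment> \<open>Joint continuity of \<open>powr\<close> fails only where base and exponent are
    both 0, a point excluded by \<open>0 < r \<or> 0 < a\<close>.\<close>
  have "uniformly_continuous_on ({r..M} \<times> {a..L}) (\<lambda>p. fst p powr snd p)"
    using assms by (intro compact_uniformly_continuous continuous_on_powr' continuous_intros compact_Times)
      auto
  then obtain d where d: "d > 0"
    "\<And>p q. p \<in> {r..M} \<times> {a..L} \<Longrightarrow> q \<in> {r..M} \<times> {a..L} \<Longrightarrow> dist p q < d
      \<Longrightarrow> dist (fst p powr snd p) (fst q powr snd q) < e / 2"
    unfolding uniformly_continuous_on_def using half_gt_zero[OF \<open>0 < e\<close>] by metis
  \<comment> \<open>The second entry bounds the phase term by \<open>N * pi * d'\<close>, at most
    \<open>e / 2\<close>.\<close>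
  define d' where "d' = min d (e / (2 * N * pi))"
  have "cmod (cpower z t - cpower z s) < e"
    if t: "t \<in> {a..L}" "s \<in> {a..L}" "\<bar>t - s\<bar> < d'" "r \<le> cmod z" "cmod z \<le> M" for t s z
  proof (cases "z = 0")
    case True
    then show ?thesis
      using assms t by (auto simp: cpower_def)
  next
    case False
    have "\<bar>cmod z powr t - cmod z powr s\<bar> < e / 2"
      using d(2)[of "(cmod z, t)" "(cmod z, s)"] t by (simp add: dist_Pair_Pair dist_real_def d'_def)
    moreover have "cmod z powr s \<le> N"
      using norm_cpower_le[of z "max M 1" s "\<bar>L\<bar>"] False t assms by (auto simp: norm_cpower N_def)
    then have "cmod z powr s * (pi * \<bar>t - s\<bar>) \<le> N * (pi * (e / (2 * N * pi)))"
      using t N by (intro mult_mono) (auto simp: d'_def)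
    then have "cmod z powr s * (pi * \<bar>t - s\<bar>) \<le> e / 2"
      using N by simp
    ultimately show ?thesis
      using norm_cpower_diff_le[OF False, of t s] by linarith
  qed
  moreover have "d' > 0"
    using d N \<open>0 < e\<close> by (simp add: d'_def)
  ultimately show ?thesis
    by blast
qed

lemma cpower_measurable: "(\<lambda>z. cpower z t) \<in> borel_measurable borel"
proof -
  have Arg: "Arg = (\<lambda>z. if z = 0 then 0 else Im (Ln z))"
    by (auto simp: Arg_eq_Im_Ln Arg_zero)
  have [measurable]: "Arg \<in> borel_measurable borel"
    unfolding Arg by measurable
  have [measurable]: "arg_lower \<in> borel_measurable borel"
    unfolding arg_lower_def by measurable
  show ?thesis
    unfolding cpower_def by measurable
qed

text \<open>Uniform continuity of \<open>P\<close> on \<open>J\<close> in operator norm, written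
  through adjoints: \<open>u\<close> is the adjoint of \<open>P t - P s\<close> applied to
  \<open>f\<close>, ready for the Bessel bound.\<close>

definition adjoint_equicontinuous_on :: "real set \<Rightarrow> (real \<Rightarrow> 'a \<Rightarrow> 'a::complex_inner) \<Rightarrow> bool"
  where "adjoint_equicontinuous_on J P \<longleftrightarrow> (\<forall>e>0. \<exists>d>0. \<forall>t\<in>J. \<forall>s\<in>J. \<bar>t - s\<bar> < d \<longrightarrow>
    (\<forall>f. \<exists>u. norm u \<le> e * norm f \<and> (\<forall>x. cinner f (P t x) - cinner f (P s x) = cinner u x)))"

lemma adjoint_equicontinuous_onE:
  assumes "adjoint_equicontinuous_on J P" "0 < e"
  obtains d where "0 < d" "\<And>t s f. t \<in> J \<Longrightarrow> s \<in> J \<Longrightarrow> \<bar>t - s\<bar> < d \<Longrightarrow>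
    \<exists>u. norm u \<le> e * norm f \<and> (\<forall>x. cinner f (P t x) - cinner f (P s x) = cinner u x)"
proof -
  from assms(1)[unfolded adjoint_equicontinuous_on_def, rule_format, OF assms(2)]
  obtain d where d: "0 < d" "\<forall>t\<in>J. \<forall>s\<in>J. \<bar>t - s\<bar> < d \<longrightarrow> (\<forall>f. \<exists>u. norm u \<le> e * norm f \<and>
      (\<forall>x. cinner f (P t x) - cinner f (P s x) = cinner u x))"
    by (elim exE conjE)
  show thesis
    by (rule that[OF d(1)]) (rule d(2)[rule_format])
qed

section \<open>Operator powers as bounded spectral integrals\<close>

context spectral_op
begin

text \<open>\<open>cpower\<close> is unbounded on the plane, so it is cut off to an annulus carrying
  almost all of every scalar measure, which changes no integral. Existence and uniqueness for the
  cut-off function then resolve the \<open>THE\<close> in \<open>operator_power\<close>.\<close>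

lemma spec_int_operator_power:
  assumes r: "\<And>x. AE z in \<mu> x. r \<le> cmod z" and M: "\<And>x. AE z in \<mu> x. cmod z \<le> M"
    and "1 \<le> M" "0 \<le> t"
  shows "spec_int (\<lambda>z. if r \<le> cmod z \<and> cmod z \<le> M then cpower z t else 0) (operator_power A E t)"
    (is "spec_int ?h _")
proof -
  have [measurable]: "(\<lambda>z. cpower z t) \<in> borel_measurable borel"
    by (rule cpower_measurable)
  have h [measurable]: "?h \<in> borel_measurable borel"
    by measurable
  have bound: "cmod (?h z) \<le> M powr t" for z
    using assms norm_cpower_le[of z M t t] by auto
  obtain B where B: "spec_int ?h B"
    using spec_int_exists[OF h bound] by blast
  have AE: "AE z in \<mu> x. ?h z = indicat_real (spectrum A) z *\<^sub>R cpower z t" for x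
    using r[of x] M[of x] AE_spectrum[of x] by eventually_elim simp
  have int: "integrable (\<mu> x) (\<lambda>z. indicat_real (spectrum A) z *\<^sub>R cpower z t)" for x
    by (rule integrable_cong_AE_imp[OF integrable_bounded[OF h bound] _ AE]) simp
  have eq: "(\<integral>z. ?h z \<partial>\<mu> x) = (\<integral>z. indicat_real (spectrum A) z *\<^sub>R cpower z t \<partial>\<mu> x)" for x
    by (rule integral_cong_AE[OF _ _ AE]) simp_all
  have iff: "has_spectral_integral E (spectrum A) (\<lambda>z. cpower z t) C \<longleftrightarrow> spec_int ?h C" for C
    unfolding has_spectral_integral_def set_integrable_def set_lebesgue_integral_def spec_int_def
    by (simp add: int eq)
  have "operator_power A E t = B"
    unfolding operator_power_def spectral_integral_def iff
  proof (rule the_equality)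
    show "C = B" if "spec_int ?h C" for C
      using that B by (intro bounded_clinear_eqI) (simp_all add: spec_int_def)
  qed (rule B)
  then show ?thesis
    using B by simp
qed

lemma operator_power_adjoint:
  "\<exists>N>0. \<forall>t\<in>{0..L}. \<forall>f. \<exists>u. norm u \<le> N * norm f \<and>
    (\<forall>x. cinner f (operator_power A E t x) = cinner u x)"
proof -
  obtain M where M: "1 \<le> M" "\<And>x. AE z in \<mu> x. cmod z \<le> M"
    using AE_bounded by blast
  have "\<exists>u. norm u \<le> 2 * (M powr L) * norm f \<and>
    (\<forall>x. cinner f (operator_power A E t x) = cinner u x)" if t: "t \<in> {0..L}" for t f
  proof (rule spec_int_adjoint)
    show "spec_int (\<lambda>z. if 0 \<le> cmod z \<and> cmod z \<le> M then cpower z t else 0) (operator_power A E t)"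
      using t M by (intro spec_int_operator_power) auto
    show "(\<lambda>z. if 0 \<le> cmod z \<and> cmod z \<le> M then cpower z t else 0) \<in> borel_measurable borel"
      using cpower_measurable[of t] by measurable
    show "cmod (if 0 \<le> cmod z \<and> cmod z \<le> M then cpower z t else 0) \<le> M powr L" for z
      using t M norm_cpower_le[of z M t L] by auto
  qed
  moreover have "2 * (M powr L) > 0"
    using M(1) by simp
  ultimately show ?thesis
    by blast
qed

lemma operator_power_equicontinuous:
  assumes a: "0 \<le> a" "0 < a \<or> invertible_operator A"
  shows "adjoint_equicontinuous_on {a..L} (operator_power A E)"
  unfolding adjoint_equicontinuous_on_def
proof (intro allI impI)
  fix e :: real assume "e > 0"
  obtain M where M: "1 \<le> M" "\<And>x. AE z in \<mu> x. cmod z \<le> M"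
    using AE_bounded by blast
  \<comment> \<open>For \<open>a > 0\<close> the disc around 0 may stay in the support; for
    \<open>a = 0\<close> invertibility removes it.\<close>
  obtain r where r: "0 \<le> r" "0 < r \<or> 0 < a" "\<And>x. AE z in \<mu> x. r \<le> cmod z"
  proof (cases "0 < a")
    case True
    then show ?thesis
      using that[of 0] by simp
  next
    case False
    then show ?thesis
      using that AE_bounded_below a by (meson less_imp_le)
  qed
  define h where "h t z = (if r \<le> cmod z \<and> cmod z \<le> M then cpower z t else 0)" for t z
  have h: "spec_int (h t) (operator_power A E t)" "cmod (h t z) \<le> M powr L" if "t \<in> {a..L}" for t z
    using that a M r spec_int_operator_power[of r M t] norm_cpower_le[of z M t L]
    by (auto simp: h_def[abs_def])
  have meas: "h t \<in> borel_measurable borel" for t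
    unfolding h_def[abs_def] using cpower_measurable[of t] by measurable
  \<comment> \<open>\<open>e / 2\<close> compensates for the factor 2 in
    \<open>spec_int_adjoint\<close>.\<close>
  obtain d where d: "d > 0" "\<And>t s z. t \<in> {a..L} \<Longrightarrow> s \<in> {a..L} \<Longrightarrow> \<bar>t - s\<bar> < d \<Longrightarrow> r \<le> cmod z
      \<Longrightarrow> cmod z \<le> M \<Longrightarrow> cmod (cpower z t - cpower z s) < e / 2"
    using cpower_uniformly_continuous[OF r(1) a(1) r(2) half_gt_zero[OF \<open>e > 0\<close>], of L M] by blast
  have "\<exists>u. norm u \<le> 2 * (e / 2) * norm f \<and>
      (\<forall>x. cinner f (operator_power A E t x - operator_power A E s x) = cinner u x)"
    if ts: "t \<in> {a..L}" "s \<in> {a..L}" "\<bar>t - s\<bar> < d" for t s f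
  proof (rule spec_int_adjoint[OF spec_int_diff[OF h(1) h(1) meas h(2) meas h(2)]])
    show "(\<lambda>z. h t z - h s z) \<in> borel_measurable borel"
      using meas[of t] meas[of s] by measurable
    show "cmod (h t z - h s z) \<le> e / 2" for z
      using d(2)[OF ts, of z] \<open>e > 0\<close> by (auto simp: h_def)
  qed (use ts in auto)
  then show "\<exists>d>0. \<forall>t\<in>{a..L}. \<forall>s\<in>{a..L}. \<bar>t - s\<bar> < d \<longrightarrow> (\<forall>f. \<exists>u. norm u \<le> e * norm f \<and>
      (\<forall>x. cinner f (operator_power A E t x) - cinner f (operator_power A E s x) = cinner u x))"
    using d(1) by (auto simp: cinner_diff_right intro!: exI[of _ d])
qed

end

section \<open>Comparison of sums and integrals\<close>

text \<open>Absorption of an error term into a lower bound. The upper bound \<open>b\<close> makes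
  \<open>D\<close> finite, so that \<open>k * x\<close> can be subtracted in the reals.\<close>

lemma ennreal_lower_bound:
  assumes le: "ennreal (c * x) \<le> ennreal (k * x) + ennreal a * D" and D: "D \<le> ennreal b"
    and "0 \<le> k" "k < c" "0 < a" "0 \<le> x"
  shows "ennreal ((c - k) / a * x) \<le> D"
proof -
  obtain y where y: "0 \<le> y" "D = ennreal y"
    using D by (metis ennreal_cases ennreal_neq_top top.extremum_uniqueI)
  have "ennreal (c * x) \<le> ennreal (k * x + a * y)"
    using le assms y by (simp add: ennreal_mult)
  then have "c * x \<le> k * x + a * y"
    using assms y by (subst (asm) ennreal_le_iff) auto
  then have "(c - k) / a * x \<le> y"
    using \<open>0 < a\<close> by (simp add: field_simps)
  then show ?thesis
    unfolding y(2) by (rule ennreal_leI)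
qed

lemma infsum_ennreal_eq_SUP:
  "(\<Sum>\<^sub>\<infinity>i\<in>I. f i :: ennreal) = (SUP F\<in>{F. finite F \<and> F \<subseteq> I}. sum f F)"
  by (rule nonneg_infsum_complete) simp

text \<open>What the comparison needs from the powers: a uniform bound \<open>N\<close> on the
  adjoints over \<open>[0, L]\<close> and equicontinuity away from 0, which holds without
  invertibility. \<open>C\<close> is the Bessel constant, restricted to finite subfamilies to keep
  the sums real.\<close>

locale adjoint_bounded_system =
  fixes P :: "real \<Rightarrow> 'a::complex_inner \<Rightarrow> 'a" and I :: "'i set" and g :: "'i \<Rightarrow> 'a"
    and L C N :: real
  assumes L: "0 < L" and C: "0 < C" and N: "0 < N"
    and bessel: "\<And>F f. finite F \<Longrightarrow> F \<subseteq> I \<Longrightarrow> (\<Sum>i\<in>F. (cmod (cinner f (g i)))\<^sup>2) \<le> C * (norm f)\<^sup>2"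
    and adjoint: "\<And>t f. t \<in> {0..L} \<Longrightarrow>
      \<exists>u. norm u \<le> N * norm f \<and> (\<forall>x. cinner f (P t x) = cinner u x)"
    and equicontinuous: "\<And>a. 0 < a \<Longrightarrow> adjoint_equicontinuous_on {a..L} P"
begin

definition \<phi> :: "'i set \<Rightarrow> 'a \<Rightarrow> real \<Rightarrow> real"
  where "\<phi> F f t = (\<Sum>i\<in>F. (cmod (cinner f (P t (g i))))\<^sup>2)"

definition discrete_sum :: "real set \<Rightarrow> 'a \<Rightarrow> ennreal"
  where "discrete_sum T f = (\<Sum>\<^sub>\<infinity>i\<in>I. \<Sum>t\<in>T. ennreal ((cmod (cinner f (P t (g i))))\<^sup>2))"

definition continuous_sum :: "'a \<Rightarrow> ennreal"
  where "continuous_sum f = (\<Sum>\<^sub>\<infinity>i\<in>I. \<integral>\<^sup>+t\<in>{0..L}. ennreal ((cmod (cinner f (P t (g i))))\<^sup>2) \<partial>lborel)"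

lemma \<phi>_nonneg: "0 \<le> \<phi> F f t"
  by (simp add: \<phi>_def sum_nonneg)

lemma \<phi>_le:
  assumes "finite F" "F \<subseteq> I" "t \<in> {0..L}"
  shows "\<phi> F f t \<le> C * N\<^sup>2 * (norm f)\<^sup>2"
proof -
  obtain u where u: "norm u \<le> N * norm f" "\<And>x. cinner f (P t x) = cinner u x"
    using adjoint[OF assms(3)] by blast
  have "\<phi> F f t \<le> C * (norm u)\<^sup>2"
    unfolding \<phi>_def u(2) by (rule bessel[OF assms(1,2)])
  also have "\<dots> \<le> C * (N * norm f)\<^sup>2"
    using C u(1) by (intro mult_left_mono power_mono) auto
  finally show ?thesis
    by (simp add: power_mult_distrib)
qed

lemma \<phi>_diff_le:
  assumes "finite F" "F \<subseteq> I"
    and u: "norm u \<le> e * norm f" "\<And>x. cinner f (P t x) - cinner f (P s x) = cinner u x"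
  shows "\<phi> F f t \<le> 2 * \<phi> F f s + 2 * C * e\<^sup>2 * (norm f)\<^sup>2"
proof -
  have "\<phi> F f t \<le> (\<Sum>i\<in>F. 2 * (cmod (cinner f (P s (g i))))\<^sup>2 + 2 * (cmod (cinner u (g i)))\<^sup>2)"
    unfolding \<phi>_def
  proof (rule sum_mono)
    fix i
    define v w where "v = cmod (cinner f (P s (g i)))" and "w = cmod (cinner u (g i))"
    have "cmod (cinner f (P t (g i))) \<le> v + w"
      unfolding v_def w_def u(2)[symmetric] by norm
    then have "(cmod (cinner f (P t (g i))))\<^sup>2 \<le> (v + w)\<^sup>2"
      by (rule power_mono) simp
    also have "\<dots> \<le> 2 * v\<^sup>2 + 2 * w\<^sup>2"
      using sum_squares_bound[of v w] by (simp add: power2_sum)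
    finally show "(cmod (cinner f (P t (g i))))\<^sup>2 \<le> 2 * v\<^sup>2 + 2 * w\<^sup>2" .
  qed
  also have "\<dots> = 2 * \<phi> F f s + 2 * (\<Sum>i\<in>F. (cmod (cinner u (g i)))\<^sup>2)"
    by (simp add: \<phi>_def sum.distrib sum_distrib_left)
  also have "(\<Sum>i\<in>F. (cmod (cinner u (g i)))\<^sup>2) \<le> C * (norm u)\<^sup>2"
    by (rule bessel[OF assms(1,2)])
  also have "C * (norm u)\<^sup>2 \<le> C * (e * norm f)\<^sup>2"
    using C u(1) by (intro mult_left_mono power_mono) auto
  finally show ?thesis
    by (simp add: power_mult_distrib)
qed

text \<open>Supplies measurability of the integrands. The point 0 is left out because the powers may
  jump there; \<open>measurable_summand\<close> treats it as a single exceptional value.\<close>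

lemma continuous_on_cinner: "continuous_on {0<..L} (\<lambda>t. cinner f (P t x))"
  unfolding continuous_on_iff
proof (intro ballI allI impI)
  fix t and e :: real assume t: "t \<in> {0<..L}" and e: "0 < e"
  \<comment> \<open>The \<open>+ 1\<close> makes \<open>k\<close> positive and the final estimate
    strict.\<close>
  define k where "k = norm f * norm x + 1"
  have k: "k > 0"
    by (simp add: k_def add_nonneg_pos)
  have "adjoint_equicontinuous_on {t / 2..L} P"
    using t by (intro equicontinuous) simp
  then obtain d where d: "d > 0" "\<And>s s' f. s \<in> {t / 2..L} \<Longrightarrow> s' \<in> {t / 2..L} \<Longrightarrow> \<bar>s - s'\<bar> < d \<Longrightarrow>
      \<exists>u. norm u \<le> (e / k) * norm f \<and> (\<forall>x. cinner f (P s x) - cinner f (P s' x) = cinner u x)"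
    using divide_pos_pos[OF e k] by (rule adjoint_equicontinuous_onE) blast
  have "dist (cinner f (P s x)) (cinner f (P t x)) < e" if s: "s \<in> {0<..L}" "dist s t < min d (t / 2)" for s
  proof -
    have "s \<in> {t / 2..L}" "t \<in> {t / 2..L}" "\<bar>s - t\<bar> < d"
      using s t by (auto simp: dist_real_def abs_if split: if_splits)
    then obtain u where u: "norm u \<le> (e / k) * norm f" "\<And>x. cinner f (P s x) - cinner f (P t x) = cinner u x"
      using d(2) by blast
    have "cmod (cinner u x) \<le> (e / k) * norm f * norm x"
      by (rule order_trans[OF Cauchy_Schwarz mult_right_mono[OF u(1)]]) simp
    also have "\<dots> = e * ((k - 1) / k)"
      by (simp add: k_def)
    also have "\<dots> < e * 1"
      using e k by (intro mult_strict_left_mono) auto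
    finally show ?thesis
      by (simp add: dist_norm u(2))
  qed
  then show "\<exists>d>0. \<forall>s\<in>{0<..L}. dist s t < d \<longrightarrow> dist (cinner f (P s x)) (cinner f (P t x)) < e"
    using d(1) t by (intro exI[of _ "min d (t / 2)"]) auto
qed

lemma measurable_summand:
  "(\<lambda>t. ennreal ((cmod (cinner f (P t x)))\<^sup>2) * indicator {0..L} t) \<in> borel_measurable borel"
proof -
  have [measurable]: "(\<lambda>t. indicat_real {0<..L} t *\<^sub>R cinner f (P t x)) \<in> borel_measurable borel"
    by (rule borel_measurable_continuous_on_indicator[OF _ continuous_on_cinner]) simp
  have "(\<lambda>t. ennreal ((cmod (cinner f (P t x)))\<^sup>2) * indicator {0..L} t) =
    (\<lambda>t. if t = 0 then ennreal ((cmod (cinner f (P 0 x)))\<^sup>2)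
      else ennreal ((cmod (indicat_real {0<..L} t *\<^sub>R cinner f (P t x)))\<^sup>2))"
    using L by (auto simp: indicator_def fun_eq_iff)
  then show ?thesis
    by simp
qed

lemma \<phi>_measurable: "(\<lambda>t. ennreal (\<phi> F f t) * indicator {0..L} t) \<in> borel_measurable borel"
proof -
  have "(\<lambda>t. ennreal (\<phi> F f t) * indicator {0..L} t) =
    (\<lambda>t. \<Sum>i\<in>F. ennreal ((cmod (cinner f (P t (g i))))\<^sup>2) * indicator {0..L} t)"
    by (simp add: \<phi>_def sum_distrib_right flip: sum_ennreal)
  also have "\<dots> \<in> borel_measurable borel"
    by (intro borel_measurable_sum measurable_summand)
  finally show ?thesis .
qed

text \<open>As suprema over finite subfamilies, this sum and \<open>continuous_sum\<close> can be
  compared one \<open>F\<close> at a time.\<close>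

lemma discrete_sum_eq:
  "discrete_sum T f = (SUP F\<in>{F. finite F \<and> F \<subseteq> I}. ennreal (\<Sum>t\<in>T. \<phi> F f t))"
proof -
  have "(\<Sum>i\<in>F. \<Sum>t\<in>T. ennreal ((cmod (cinner f (P t (g i))))\<^sup>2)) = ennreal (\<Sum>t\<in>T. \<phi> F f t)" for F
    unfolding \<phi>_def by (subst sum.swap) (simp add: sum_nonneg)
  then show ?thesis
    unfolding discrete_sum_def infsum_ennreal_eq_SUP by simp
qed

lemma continuous_sum_eq:
  "continuous_sum f = (SUP F\<in>{F. finite F \<and> F \<subseteq> I}. \<integral>\<^sup>+t\<in>{0..L}. ennreal (\<phi> F f t) \<partial>lborel)"
proof -
  have "(\<Sum>i\<in>F. \<integral>\<^sup>+t\<in>{0..L}. ennreal ((cmod (cinner f (P t (g i))))\<^sup>2) \<partial>lborel)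
      = (\<integral>\<^sup>+t\<in>{0..L}. ennreal (\<phi> F f t) \<partial>lborel)" for F
    using measurable_summand
    by (subst nn_integral_sum[symmetric]) (simp_all add: \<phi>_def sum_distrib_right flip: sum_ennreal)
  then show ?thesis
    unfolding continuous_sum_def infsum_ennreal_eq_SUP by simp
qed

lemma discrete_sum_le:
  assumes "T \<subseteq> {0..L}"
  shows "discrete_sum T f \<le> ennreal (card T * (C * N\<^sup>2) * (norm f)\<^sup>2)"
  unfolding discrete_sum_eq
proof (intro SUP_least ennreal_leI)
  fix F assume "F \<in> {F. finite F \<and> F \<subseteq> I}"
  then have "\<phi> F f t \<le> C * N\<^sup>2 * (norm f)\<^sup>2" if "t \<in> T" for t
    using \<phi>_le that assms by auto
  from sum_bounded_above[OF this] show "(\<Sum>t\<in>T. \<phi> F f t) \<le> card T * (C * N\<^sup>2) * (norm f)\<^sup>2"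
    by (simp add: mult.assoc)
qed

lemma continuous_sum_le: "continuous_sum f \<le> ennreal (L * (C * N\<^sup>2) * (norm f)\<^sup>2)"
  unfolding continuous_sum_eq
proof (intro SUP_least)
  fix F assume "F \<in> {F. finite F \<and> F \<subseteq> I}"
  then have "(\<integral>\<^sup>+t\<in>{0..L}. ennreal (\<phi> F f t) \<partial>lborel)
      \<le> (\<integral>\<^sup>+t\<in>{0..L}. ennreal (C * N\<^sup>2 * (norm f)\<^sup>2) \<partial>lborel)"
    using \<phi>_le[of F _ f] by (intro nn_integral_mono) (auto intro!: ennreal_leI simp: indicator_def)
  also have "\<dots> = ennreal (L * (C * N\<^sup>2) * (norm f)\<^sup>2)"
    using L C by (subst nn_integral_cmult_indicator) (simp_all add: mult_ac flip: ennreal_mult)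
  finally show "(\<integral>\<^sup>+t\<in>{0..L}. ennreal (\<phi> F f t) \<partial>lborel) \<le> ennreal (L * (C * N\<^sup>2) * (norm f)\<^sup>2)" .
qed

lemma discrete_frameI:
  assumes "T \<subseteq> {0..L}" "0 < c" "\<And>f. ennreal (c * (norm f)\<^sup>2) \<le> discrete_sum T f"
  shows "discrete_frame P I g T"
proof -
  \<comment> \<open>The \<open>+ 1\<close> keeps the upper constant positive when
    \<open>card T\<close> is 0.\<close>
  have "discrete_sum T f \<le> ennreal ((card T * (C * N\<^sup>2) + 1) * (norm f)\<^sup>2)" for f
    by (rule order_trans[OF discrete_sum_le[OF assms(1)] ennreal_leI]) (simp add: algebra_simps)
  moreover have "card T * (C * N\<^sup>2) + 1 > 0"
    using C by (intro add_nonneg_pos) auto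
  ultimately show ?thesis
    unfolding discrete_frame_def discrete_sum_def[symmetric] using assms(2,3) by blast
qed

lemma semicontinuous_frameI:
  assumes "0 < c" "\<And>f. ennreal (c * (norm f)\<^sup>2) \<le> continuous_sum f"
  shows "semicontinuous_frame P I g L"
proof -
  have "0 < L * (C * N\<^sup>2)"
    using L C N by simp
  then show ?thesis
    unfolding semicontinuous_frame_def continuous_sum_def[symmetric]
    using assms continuous_sum_le by blast
qed

end

section \<open>Partitions of an interval\<close>

lemma partition_interval:
  fixes t :: "nat \<Rightarrow> real"
  assumes "1 \<le> n" "t 1 \<le> x" "x \<le> t (n + 1)"
  shows "\<exists>j\<in>{1..n}. t j \<le> x \<and> x \<le> t (j + 1)"
  using assms
proof (induction n rule: dec_induct)
  case base
  then show ?case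
    by auto
next
  case (step n)
  then show ?case
  proof (cases "x \<le> t (n + 1)")
    case True
    then obtain j where "j \<in> {1..n}" "t j \<le> x" "x \<le> t (j + 1)"
      using step by auto
    then show ?thesis
      by (intro bexI[of _ j]) auto
  next
    case False
    then show ?thesis
      using step by (intro bexI[of _ "Suc n"]) auto
  qed
qed

lemma partition_less:
  fixes t :: "nat \<Rightarrow> real"
  assumes "\<forall>i\<in>{1..n}. t i < t (i + 1)" "1 \<le> i" "i < j" "j \<le> n + 1"
  shows "t i < t j"
  using assms(3,4)
proof (induction j)
  case (Suc j)
  have "t j < t (Suc j)"
    using assms(1,2) Suc.prems by (simp add: Ball_def)
  then show ?case
    using Suc by (cases "i = j") auto
qed simp

section \<open>Passage between sampled and continuous systems\<close>

context adjoint_bounded_system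
begin

text \<open>Each sample \<open>t\<close> is compared with the integral of \<phi> over
  \<open>[t, t + d]\<close>, on which the powers hardly change. These intervals may overlap;
  bounding each integral by the one over \<open>[0, L]\<close> costs a factor
  \<open>n\<close>.\<close>

lemma semicontinuous_frame_of_discrete:
  assumes equi: "adjoint_equicontinuous_on {0..L} P" and T: "finite T" "T \<noteq> {}" "T \<subseteq> {0..<L}"
    and frame: "discrete_frame P I g T"
  shows "semicontinuous_frame P I g L"
proof -
  obtain c where c: "0 < c" "\<And>f. ennreal (c * (norm f)\<^sup>2) \<le> discrete_sum T f"
    using frame unfolding discrete_frame_def discrete_sum_def by blast
  define n where "n = real (card T)"
  have n: "0 < n"
    using T by (simp add: n_def card_gt_0_iff)
  \<comment> \<open>Makes the errors of all samples, \<open>n * K\<close>, add up to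
    \<open>c / 2 * (norm f)\<^sup>2\<close>.\<close>
  define e where "e = sqrt (c / (4 * C * n))"
  have e: "0 < e" "e\<^sup>2 = c / (4 * C * n)"
    using c C n by (simp_all add: e_def)
  obtain d0 where d0: "0 < d0" "\<And>t s f. t \<in> {0..L} \<Longrightarrow> s \<in> {0..L} \<Longrightarrow> \<bar>t - s\<bar> < d0 \<Longrightarrow>
      \<exists>u. norm u \<le> e * norm f \<and> (\<forall>x. cinner f (P t x) - cinner f (P s x) = cinner u x)"
    using equi e(1) by (rule adjoint_equicontinuous_onE) blast
  \<comment> \<open>Halving gives \<open>d < d0\<close>. The second entry keeps
    \<open>[t, t + d]\<close> inside \<open>[0, L]\<close>; it is positive because all samples lie
    strictly below \<open>L\<close>.\<close>
  define d where "d = min (d0 / 2) (L - Max T)"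
  have d: "0 < d" "d < d0"
    using d0 T Max_in[OF T(1,2)] by (auto simp: d_def)
  have dL: "t + d \<le> L" if "t \<in> T" for t
    using Max_ge[OF T(1) that] by (simp add: d_def)
  have "ennreal ((d * c - d * (c / 2)) / (2 * n) * (norm f)\<^sup>2) \<le> continuous_sum f" for f
  proof (rule ennreal_lower_bound[OF _ continuous_sum_le])
    define K where "K = 2 * C * e\<^sup>2 * (norm f)\<^sup>2"
    have K: "0 \<le> K"
      using C by (simp add: K_def)
    have le: "ennreal d * ennreal (\<Sum>t\<in>T. \<phi> F f t) \<le> ennreal (n * (K * d)) + ennreal (2 * n) * continuous_sum f"
      if F: "finite F" "F \<subseteq> I" for F
    proof -
      define J where "J = (\<integral>\<^sup>+s\<in>{0..L}. ennreal (\<phi> F f s) \<partial>lborel)"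
      have "ennreal (d * \<phi> F f t) \<le> 2 * J + ennreal (K * d)" if t: "t \<in> T" for t
      proof -
        have pt: "ennreal (\<phi> F f t) * indicator {t..t + d} s
            \<le> 2 * (ennreal (\<phi> F f s) * indicator {0..L} s) + ennreal K * indicator {t..t + d} s" for s
        proof (cases "s \<in> {t..t + d}")
          case True
          then have s: "s \<in> {0..L}" "t \<in> {0..L}" "\<bar>t - s\<bar> < d0"
            using t T dL[OF t] d by auto
          then obtain u where "norm u \<le> e * norm f" "\<And>x. cinner f (P t x) - cinner f (P s x) = cinner u x"
            using d0(2) by blast
          from \<phi>_diff_le[OF F this] have "\<phi> F f t \<le> 2 * \<phi> F f s + K"
            by (simp add: K_def)
          then have "ennreal (\<phi> F f t) \<le> ennreal (2 * \<phi> F f s + K)"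
            by (rule ennreal_leI)
          also have "\<dots> = 2 * ennreal (\<phi> F f s) + ennreal K"
            using \<phi>_nonneg[of F f s] K by (simp add: ennreal_mult)
          finally have "ennreal (\<phi> F f t) \<le> 2 * ennreal (\<phi> F f s) + ennreal K" .
          then show ?thesis
            using True s by simp
        qed simp
        have "ennreal (d * \<phi> F f t) = (\<integral>\<^sup>+s. ennreal (\<phi> F f t) * indicator {t..t + d} s \<partial>lborel)"
          using d \<phi>_nonneg[of F f t] by (subst nn_integral_cmult_indicator) (simp_all add: mult.commute flip: ennreal_mult)
        also have "\<dots> \<le> (\<integral>\<^sup>+s. 2 * (ennreal (\<phi> F f s) * indicator {0..L} s) + ennreal K * indicator {t..t + d} s \<partial>lborel)"
          by (intro nn_integral_mono pt)
        also have "\<dots> = (\<integral>\<^sup>+s. 2 * (ennreal (\<phi> F f s) * indicator {0..L} s) \<partial>lborel) + (\<integral>\<^sup>+s. ennreal K * indicator {t..t + d} s \<partial>lborel)"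
          using \<phi>_measurable[of F f] by (intro nn_integral_add) simp_all
        also have "\<dots> = 2 * J + ennreal (K * d)"
          unfolding J_def using \<phi>_measurable[of F f] d K
          by (subst nn_integral_cmult, simp, subst nn_integral_cmult_indicator) (simp_all flip: ennreal_mult)
        finally show ?thesis .
      qed
      then have "(\<Sum>t\<in>T. ennreal (d * \<phi> F f t)) \<le> of_nat (card T) * (2 * J + ennreal (K * d))"
        by (rule sum_bounded_above)
      also have "(\<Sum>t\<in>T. ennreal (d * \<phi> F f t)) = ennreal d * ennreal (\<Sum>t\<in>T. \<phi> F f t)"
        using d \<phi>_nonneg[of F f] by (simp add: sum_distrib_left sum_nonneg flip: ennreal_mult)
      also have "of_nat (card T) * (2 * J + ennreal (K * d)) = ennreal (n * (K * d)) + ennreal (2 * n) * J"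
        using K d n by (simp add: n_def distrib_left ennreal_mult ennreal_of_nat_eq_real_of_nat ac_simps)
      also have "J \<le> continuous_sum f"
        unfolding J_def continuous_sum_eq using F by (intro SUP_upper) simp
      finally show ?thesis
        by (simp add: add_left_mono mult_left_mono)
    qed
    have "ennreal (d * c * (norm f)\<^sup>2) = ennreal d * ennreal (c * (norm f)\<^sup>2)"
      using d c by (simp add: mult.assoc flip: ennreal_mult)
    also have "\<dots> \<le> ennreal d * discrete_sum T f"
      by (intro mult_left_mono c) simp
    also have "\<dots> \<le> ennreal (n * (K * d)) + ennreal (2 * n) * continuous_sum f"
      unfolding discrete_sum_eq SUP_mult_left_ennreal by (intro SUP_least) (use le in auto)
    also have "n * (K * d) = d * (c / 2) * (norm f)\<^sup>2"
      using C n by (simp add: K_def e field_simps)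
    finally show "ennreal (d * c * (norm f)\<^sup>2) \<le> ennreal (d * (c / 2) * (norm f)\<^sup>2) + ennreal (2 * n) * continuous_sum f" .
  qed (use c d n in auto)
  then show ?thesis
    using c d n by (intro semicontinuous_frameI[of "(d * c - d * (c / 2)) / (2 * n)"]) auto
qed

text \<open>The integral is dominated, up to errors, by a left-endpoint Riemann sum whose cells have
  width below \<delta>. All constants depend only on the system and \<open>c\<close>, so one
  \<delta> serves every partition.\<close>

lemma discrete_frame_of_semicontinuous:
  assumes frame: "semicontinuous_frame P I g L"
  shows "\<exists>\<delta>>0. \<forall>(n::nat) (t::nat \<Rightarrow> real).
        1 \<le> n \<longrightarrow> t 1 = 0 \<longrightarrow> t (n + 1) = L \<longrightarrow>
        (\<forall>i\<in>{1..n}. t i < t (i + 1)) \<longrightarrow>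
        (\<forall>i\<in>{1..n}. \<bar>t (i + 1) - t i\<bar> < \<delta>) \<longrightarrow>
        discrete_frame P I g (t ` {1..n})"
proof -
  obtain c where c: "0 < c" "\<And>f. ennreal (c * (norm f)\<^sup>2) \<le> continuous_sum f"
    using frame unfolding semicontinuous_frame_def continuous_sum_def by blast
  \<comment> \<open>With these choices \<open>K * (2 * \<eta>)\<close> and \<open>K' * L\<close>
    below both equal \<open>c / 4 * (norm f)\<^sup>2\<close>: half of the lower bound is spent on
    errors.\<close>
  define \<eta> where "\<eta> = c / (8 * (C * N\<^sup>2))"
  define e where "e = sqrt (c / (8 * C * L))"
  have \<eta>: "0 < \<eta>"
    using c C N by (simp add: \<eta>_def)
  have e: "0 < e" "e\<^sup>2 = c / (8 * C * L)"
    using c C L by (simp_all add: e_def)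
  obtain d0 where d0: "0 < d0" "\<And>t s f. t \<in> {\<eta>..L} \<Longrightarrow> s \<in> {\<eta>..L} \<Longrightarrow> \<bar>t - s\<bar> < d0 \<Longrightarrow>
      \<exists>u. norm u \<le> e * norm f \<and> (\<forall>x. cinner f (P t x) - cinner f (P s x) = cinner u x)"
    using equicontinuous[OF \<eta>] e(1) by (rule adjoint_equicontinuous_onE) blast
  \<comment> \<open>The bound \<eta> on the mesh ensures that a cell containing some
    \<open>s > 2 * \<eta>\<close> starts after \<eta>, where equicontinuity is available.\<close>
  define \<delta> where "\<delta> = min d0 \<eta>"
  have \<delta>: "0 < \<delta>"
    using d0 \<eta> by (simp add: \<delta>_def)
  have "discrete_frame P I g (t ` {1..n})"
    if t: "1 \<le> n" "t 1 = 0" "t (n + 1) = L" "\<forall>i\<in>{1..n}. t i < t (i + 1)"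
      "\<forall>i\<in>{1..n}. \<bar>t (i + 1) - t i\<bar> < \<delta>" for n :: nat and t :: "nat \<Rightarrow> real"
  proof -
    note less = partition_less[OF t(4)]
    \<comment> \<open>The frame sums over the set of nodes, the Riemann sum over their
      indices.\<close>
    have inj: "inj_on t {1..n}"
      by (rule linorder_inj_onI) (use less in force)+
    have tL: "t i \<in> {0..L}" if "i \<in> {1..n}" for i
      using less[of 1 i] less[of i "n + 1"] that t(2,3) by (cases "i = 1") auto
    have T: "t ` {1..n} \<subseteq> {0..L}"
      using tL by blast
    have "ennreal ((c - c / 2) / (2 * \<delta>) * (norm f)\<^sup>2) \<le> discrete_sum (t ` {1..n}) f" for f
    proof (rule ennreal_lower_bound[OF _ discrete_sum_le[OF T]])
      define K where "K = C * N\<^sup>2 * (norm f)\<^sup>2"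
      define K' where "K' = 2 * C * e\<^sup>2 * (norm f)\<^sup>2"
      have K: "0 \<le> K" "0 \<le> K'"
        using C by (simp_all add: K_def K'_def)
      have "ennreal (c * (norm f)\<^sup>2) \<le> continuous_sum f"
        by (rule c)
      also have "\<dots> \<le> ennreal (c / 2 * (norm f)\<^sup>2) + ennreal (2 * \<delta>) * discrete_sum (t ` {1..n}) f"
        unfolding continuous_sum_eq
      proof (rule SUP_least)
        fix F assume "F \<in> {F. finite F \<and> F \<subseteq> I}"
        then have F: "finite F" "F \<subseteq> I"
          by auto
        let ?b = "\<lambda>j s. ennreal (2 * \<phi> F f (t j)) * indicator {t j..t (j + 1)} s"
        \<comment> \<open>The three terms are the crude bound near 0, the continuity error, and the
          step function of samples. Closed cells share endpoints, but only an upper bound is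
          wanted.\<close>
        have pt: "ennreal (\<phi> F f s) * indicator {0..L} s
            \<le> (ennreal K * indicator {0..2 * \<eta>} s + ennreal K' * indicator {0..L} s) + (\<Sum>j\<in>{1..n}. ?b j s)" for s
        proof (cases "s \<in> {0..L}")
          case s: True
          show ?thesis
          proof (cases "s \<le> 2 * \<eta>")
            case True
            have "ennreal (\<phi> F f s) \<le> ennreal K"
              using \<phi>_le[OF F s] by (simp add: K_def ennreal_leI)
            then show ?thesis
              using s True by (simp add: add_increasing2 add.assoc)
          next
            case False
            obtain j where j: "j \<in> {1..n}" "t j \<le> s" "s \<le> t (j + 1)"
              using partition_interval[of n t s] t(1-3) s by auto
            then have "\<bar>t (j + 1) - t j\<bar> < \<delta>"
              using t(5) by blast
            then have "t j \<in> {\<eta>..L}" "s \<in> {\<eta>..L}" "\<bar>s - t j\<bar> < d0"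
              using j s False tL[OF j(1)] \<eta> by (auto simp: \<delta>_def)
            then obtain u where "norm u \<le> e * norm f" "\<And>x. cinner f (P s x) - cinner f (P (t j) x) = cinner u x"
              using d0(2) by blast
            from \<phi>_diff_le[OF F this] have "ennreal (\<phi> F f s) \<le> ennreal (K' + 2 * \<phi> F f (t j))"
              by (intro ennreal_leI) (simp add: K'_def)
            also have "\<dots> = ennreal K' + ?b j s"
              using K \<phi>_nonneg[of F f "t j"] j by simp
            also have "?b j s \<le> (\<Sum>j\<in>{1..n}. ?b j s)"
              by (rule member_le_sum[OF j(1)]) auto
            finally show ?thesis
              using s False by (simp add: add_left_mono)
          qed
        qed simp
        have "(\<integral>\<^sup>+s\<in>{0..L}. ennreal (\<phi> F f s) \<partial>lborel)
            \<le> (\<integral>\<^sup>+s. (ennreal K * indicator {0..2 * \<eta>} s + ennreal K' * indicator {0..L} s) + (\<Sum>j\<in>{1..n}. ?b j s) \<partial>lborel)"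
          by (intro nn_integral_mono pt)
        also have "\<dots> = ennreal K * ennreal (2 * \<eta>) + ennreal K' * ennreal L
            + (\<Sum>j\<in>{1..n}. ennreal (2 * \<phi> F f (t j)) * ennreal (t (j + 1) - t j))"
        proof -
          have int: "(\<integral>\<^sup>+s. a * indicator {u..v} s \<partial>lborel) = a * ennreal (v - u)" if "u \<le> v" for a u v
            using that by (simp add: nn_integral_cmult_indicator)
          have "(\<integral>\<^sup>+s. (ennreal K * indicator {0..2 * \<eta>} s + ennreal K' * indicator {0..L} s) + (\<Sum>j\<in>{1..n}. ?b j s) \<partial>lborel)
              = (\<integral>\<^sup>+s. ennreal K * indicator {0..2 * \<eta>} s + ennreal K' * indicator {0..L} s \<partial>lborel)
                + (\<integral>\<^sup>+s. (\<Sum>j\<in>{1..n}. ?b j s) \<partial>lborel)"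
            by (rule nn_integral_add) measurable
          also have "(\<integral>\<^sup>+s. ennreal K * indicator {0..2 * \<eta>} s + ennreal K' * indicator {0..L} s \<partial>lborel)
              = (\<integral>\<^sup>+s. ennreal K * indicator {0..2 * \<eta>} s \<partial>lborel) + (\<integral>\<^sup>+s. ennreal K' * indicator {0..L} s \<partial>lborel)"
            by (rule nn_integral_add) measurable
          also have "(\<integral>\<^sup>+s. (\<Sum>j\<in>{1..n}. ?b j s) \<partial>lborel) = (\<Sum>j\<in>{1..n}. \<integral>\<^sup>+s. ?b j s \<partial>lborel)"
            by (rule nn_integral_sum) measurable
          also have "\<dots> = (\<Sum>j\<in>{1..n}. ennreal (2 * \<phi> F f (t j)) * ennreal (t (j + 1) - t j))"
            using t(4) by (intro sum.cong int) (auto simp: less_imp_le)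
          finally show ?thesis
            using L \<eta> by (simp add: int)
        qed
        also have "\<dots> \<le> ennreal K * ennreal (2 * \<eta>) + ennreal K' * ennreal L
            + (\<Sum>j\<in>{1..n}. ennreal (2 * \<phi> F f (t j)) * ennreal \<delta>)"
        proof (intro add_left_mono sum_mono mult_left_mono ennreal_leI)
          fix j assume "j \<in> {1..n}"
          from bspec[OF t(5) this] show "t (j + 1) - t j \<le> \<delta>"
            by linarith
        qed simp
        also have "ennreal K * ennreal (2 * \<eta>) + ennreal K' * ennreal L = ennreal (K * (2 * \<eta>) + K' * L)"
          using K \<eta> L by (simp add: ennreal_mult)
        also have "K * (2 * \<eta>) + K' * L = c / 2 * (norm f)\<^sup>2"
          using C L N by (simp add: K_def K'_def e \<eta>_def field_simps)
        also have "(\<Sum>j\<in>{1..n}. ennreal (2 * \<phi> F f (t j)) * ennreal \<delta>) = ennreal (\<Sum>j\<in>{1..n}. 2 * \<phi> F f (t j) * \<delta>)"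
          using \<delta> \<phi>_nonneg[of F f] by (subst sum_ennreal[symmetric]) (simp_all add: ennreal_mult)
        also have "(\<Sum>j\<in>{1..n}. 2 * \<phi> F f (t j) * \<delta>) = 2 * \<delta> * (\<Sum>x\<in>t ` {1..n}. \<phi> F f x)"
          unfolding sum.reindex[OF inj] by (simp add: sum_distrib_left mult_ac)
        also have "ennreal \<dots> = ennreal (2 * \<delta>) * ennreal (\<Sum>x\<in>t ` {1..n}. \<phi> F f x)"
          using \<delta> \<phi>_nonneg[of F f] by (intro ennreal_mult sum_nonneg) auto
        also have "ennreal (\<Sum>x\<in>t ` {1..n}. \<phi> F f x) \<le> discrete_sum (t ` {1..n}) f"
          unfolding discrete_sum_eq using F by (intro SUP_upper) simp
        finally show "(\<integral>\<^sup>+s\<in>{0..L}. ennreal (\<phi> F f s) \<partial>lborel)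
            \<le> ennreal (c / 2 * (norm f)\<^sup>2) + ennreal (2 * \<delta>) * discrete_sum (t ` {1..n}) f"
          by (simp add: add_left_mono mult_left_mono)
      qed
      finally show "ennreal (c * (norm f)\<^sup>2)
          \<le> ennreal (c / 2 * (norm f)\<^sup>2) + ennreal (2 * \<delta>) * discrete_sum (t ` {1..n}) f" .
    qed (use c \<delta> in auto)
    then show ?thesis
      using c \<delta> by (intro discrete_frameI[OF T, of "(c - c / 2) / (2 * \<delta>)"]) auto
  qed
  then show ?thesis
    using \<delta> by blast
qed

end

section \<open>Application to the powers of a normal operator\<close>

theorem theorem5p4:
  fixes A :: "'a::chilbert_space \<Rightarrow> 'a"
    and E :: "complex set \<Rightarrow> 'a \<Rightarrow> 'a"
    and I :: "'i set" and g :: "'i \<Rightarrow> 'a"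
    and L :: real
  assumes "separable_space (euclidean :: 'a topology)"
    and "normal_operator A"
    and "spectral_measure_of A E"
    and "countable I"
    and "bessel_system I g"
    and "0 < L"
  shows "(semicontinuous_frame (operator_power A E) I g L \<longrightarrow>
      (\<exists>\<delta>>0. \<forall>(n::nat) (t::nat \<Rightarrow> real).
        1 \<le> n \<longrightarrow> t 1 = 0 \<longrightarrow> t (n + 1) = L \<longrightarrow>
        (\<forall>i\<in>{1..n}. t i < t (i + 1)) \<longrightarrow>
        (\<forall>i\<in>{1..n}. \<bar>t (i + 1) - t i\<bar> < \<delta>) \<longrightarrow>
        discrete_frame (operator_power A E) I g (t ` {1..n})))
    \<and> (invertible_operator A \<longrightarrow>
      (semicontinuous_frame (operator_power A E) I g L \<longleftrightarrow>
        (\<exists>(n::nat) (t::nat \<Rightarrow> real).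
          1 \<le> n \<and> t 1 = 0 \<and> (\<forall>i\<in>{1..<n}. t i < t (i + 1)) \<and> t n < L \<and>
          discrete_frame (operator_power A E) I g (t ` {1..n}))))"
proof -
  interpret spectral_op E A
    using assms(3) by unfold_locales (simp_all add: spectral_measure_of_def)
  let ?P = "operator_power A E"
  obtain N where N: "0 < N" "\<And>t f. t \<in> {0..L} \<Longrightarrow>
      \<exists>u. norm u \<le> N * norm f \<and> (\<forall>x. cinner f (?P t x) = cinner u x)"
    using operator_power_adjoint[of L] by blast
  obtain C where C: "0 < C"
    "\<And>f. (\<Sum>\<^sub>\<infinity>i\<in>I. ennreal ((cmod (cinner f (g i)))\<^sup>2)) \<le> ennreal (C * (norm f)\<^sup>2)"
    using assms(5) unfolding bessel_system_def by blast
  have bessel: "(\<Sum>i\<in>F. (cmod (cinner f (g i)))\<^sup>2) \<le> C * (norm f)\<^sup>2" if "finite F" "F \<subseteq> I" for F f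
  proof -
    have "ennreal (\<Sum>i\<in>F. (cmod (cinner f (g i)))\<^sup>2) \<le> (\<Sum>\<^sub>\<infinity>i\<in>I. ennreal ((cmod (cinner f (g i)))\<^sup>2))"
      unfolding infsum_ennreal_eq_SUP using that by (subst sum_ennreal[symmetric]) (auto intro: SUP_upper)
    also have "\<dots> \<le> ennreal (C * (norm f)\<^sup>2)"
      by (rule C)
    finally show ?thesis
      using C(1) by (simp add: ennreal_le_iff)
  qed
  interpret adjoint_bounded_system ?P I g L C N
    by unfold_locales (use assms(6) C(1) N bessel operator_power_equicontinuous in auto)
  have part1: "semicontinuous_frame ?P I g L \<Longrightarrow> \<exists>\<delta>>0. \<forall>(n::nat) (t::nat \<Rightarrow> real).
        1 \<le> n \<longrightarrow> t 1 = 0 \<longrightarrow> t (n + 1) = L \<longrightarrow>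
        (\<forall>i\<in>{1..n}. t i < t (i + 1)) \<longrightarrow>
        (\<forall>i\<in>{1..n}. \<bar>t (i + 1) - t i\<bar> < \<delta>) \<longrightarrow>
        discrete_frame ?P I g (t ` {1..n})"
    by (rule discrete_frame_of_semicontinuous)
  have "\<exists>(n::nat) (t::nat \<Rightarrow> real).
          1 \<le> n \<and> t 1 = 0 \<and> (\<forall>i\<in>{1..<n}. t i < t (i + 1)) \<and> t n < L \<and>
          discrete_frame ?P I g (t ` {1..n})" if semi: "semicontinuous_frame ?P I g L"
  proof -
    obtain \<delta> where \<delta>: "0 < \<delta>" and frame: "\<And>(n::nat) (t::nat \<Rightarrow> real).
        1 \<le> n \<Longrightarrow> t 1 = 0 \<Longrightarrow> t (n + 1) = L \<Longrightarrow>
        \<forall>i\<in>{1..n}. t i < t (i + 1) \<Longrightarrow>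
        \<forall>i\<in>{1..n}. \<bar>t (i + 1) - t i\<bar> < \<delta> \<Longrightarrow>
        discrete_frame ?P I g (t ` {1..n})"
      using part1[OF semi] by blast
    obtain m where "L / \<delta> < real m"
      using reals_Archimedean2 by blast
    then have m: "L / real (Suc m) < \<delta>"
      using \<delta> L by (simp add: field_simps)
    define h where "h = L / real (Suc m)"
    \<comment> \<open>Nodes are numbered from 1: node 1 is 0 and node \<open>Suc m + 1\<close> is
      \<open>L\<close>, which the sample set leaves out.\<close>
    define t where "t i = (real i - 1) * h" for i
    have h: "0 < h" "h < \<delta>" "real (Suc m) * h = L"
      using m L by (simp_all add: h_def del: of_nat_Suc)
    have step: "t (i + 1) - t i = h" for i
      by (simp add: t_def algebra_simps)
    have incr: "t i < t (i + 1)" for i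
      using step[of i] h by linarith
    have fin: "t (Suc m + 1) = L"
      using h(3) by (simp add: t_def)
    have "discrete_frame ?P I g (t ` {1..Suc m})"
    proof (rule frame)
      show "\<forall>i\<in>{1..Suc m}. \<bar>t (i + 1) - t i\<bar> < \<delta>"
        unfolding step using h by simp
      show "\<forall>i\<in>{1..Suc m}. t i < t (i + 1)"
        using incr by blast
    qed (use fin in \<open>simp_all add: t_def\<close>)
    moreover have "t (Suc m) < L"
      using incr[of "Suc m"] fin by simp
    ultimately show ?thesis
      using incr by (intro exI[of _ "Suc m"] exI[of _ t] conjI ballI) (simp_all add: t_def)
  qed
  moreover have "semicontinuous_frame ?P I g L"
    if inv: "invertible_operator A" and t: "1 \<le> n" "t 1 = 0" "\<forall>i\<in>{1..<n}. t i < t (i + 1)" "t n < L"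
      and frame: "discrete_frame ?P I g (t ` {1..n})" for n :: nat and t :: "nat \<Rightarrow> real"
  proof (rule semicontinuous_frame_of_discrete[OF _ _ _ _ frame])
    \<comment> \<open>Here the chain of inequalities stops at node \<open>n\<close>, so
      \<open>partition_less\<close> is used with \<open>n - 1\<close>; \<open>1 \<le> n\<close>
      gives \<open>n - 1 + 1 = n\<close>.\<close>
    have "{1..n - 1} \<subseteq> {1..<n}"
      using t(1) by auto
    then have "\<forall>i\<in>{1..n - 1}. t i < t (i + 1)"
      using t(3) by blast
    note less = partition_less[OF this]
    have "t i \<in> {0..<L}" if "i \<in> {1..n}" for i
      using less[of 1 i] less[of i n] that t(1,2,4) by (cases "i = 1"; cases "i = n") auto
    then show "t ` {1..n} \<subseteq> {0..<L}"
      by blast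
    show "adjoint_equicontinuous_on {0..L} ?P"
      using inv by (intro operator_power_equicontinuous) auto
  qed (use t(1) in auto)
  ultimately show ?thesis
    using part1 by blast
qed

end
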